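(* Let $\Delta = n^2 - 4$ with an integer $n \ge 0$ such that $\Delta$ is a quadratic discriminant, and let $h_\Delta$ be the (wide) class number of the order $\mathcal{O}_\Delta$. (1) If $\mathcal{O}_\Delta$ is a maximal order, $n = 2m$ is even, and $h_\Delta = 1$, then $m \in \{0, 2\}$, so $n \in \{0,4\}$ and $\Delta \in \{-4, 12\}$. (2) If $n \equiv 2 \pmod 4$, write $n = 2m$; if $m > 3$, then $h_\Delta$ is even (whether or not $\mathcal{O}_\Delta$ is maximal). For $m = 3$, i.e. $\Delta = 32$, one has $h_\Delta = 1$.
   Context: A quadratic discriminant is a nonsquare integer $\equiv 0,1\pmod 4$. For such $\Delta$, $\mathcal{O}_\Delta = \mathbb{Z}[\frac{\Delta+\sqrt\Delta}{2}]$ is the quadratic order of discriminant $\Delta$; it is maximal iff $\Delta$ is a fundamental discriminant. The (wide) class number $h_\Delta$ is the order of the group of invertible fractional ideals of $\mathcal{O}_\Delta$ modulo principal fractional ideals. *)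

theory Defs
  imports Complex_Main "HOL-Algebra.Coset" "HOL-Computational_Algebra.Polynomial"
begin

definition quad_discriminant :: "int \<Rightarrow> bool" where
  "quad_discriminant \<Delta> \<longleftrightarrow> (\<nexists>k. \<Delta> = k\<^sup>2) \<and> (\<Delta> mod 4 = 0 \<or> \<Delta> mod 4 = 1)"

text \<open>The field \<open>\<rat>(\<surd>\<Delta>)\<close> is realised inside the complex numbers.\<close>

definition quad_field :: "int \<Rightarrow> complex set" where
  "quad_field \<Delta> = {of_rat a + of_rat b * csqrt (of_int \<Delta>) | a b. True}"

definition quad_gen :: "int \<Rightarrow> complex" where
  "quad_gen \<Delta> = (of_int \<Delta> + csqrt (of_int \<Delta>)) / 2"

definition quad_order :: "int \<Rightarrow> complex set" where
  "quad_order \<Delta> = {poly (map_poly of_int p) (quad_gen \<Delta>) | p :: int poly. True}"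

text \<open>The conditions say: subring of the field, finitely generated as a \<open>\<int>\<close>-module,
  spanning the field over \<open>\<rat>\<close>.\<close>

definition order_in_quad_field :: "int \<Rightarrow> complex set \<Rightarrow> bool" where
  "order_in_quad_field \<Delta> R \<longleftrightarrow>
     R \<subseteq> quad_field \<Delta> \<and> 1 \<in> R \<and> (\<forall>x\<in>R. \<forall>y\<in>R. x - y \<in> R \<and> x * y \<in> R) \<and>
     (\<exists>B. finite B \<and> R = {\<Sum>b\<in>B. of_int (c b) * b | c. True}) \<and>
     quad_field \<Delta> = {of_rat q * x | q x. x \<in> R}"

definition maximal_order :: "int \<Rightarrow> complex set \<Rightarrow> bool" where
  "maximal_order \<Delta> R \<longleftrightarrow>
     order_in_quad_field \<Delta> R \<and> (\<forall>S. order_in_quad_field \<Delta> S \<and> R \<subseteq> S \<longrightarrow> S = R)"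

definition fractional_ideal :: "int \<Rightarrow> complex set \<Rightarrow> bool" where
  "fractional_ideal \<Delta> I \<longleftrightarrow>
     I \<subseteq> quad_field \<Delta> \<and> 0 \<in> I \<and> I \<noteq> {0} \<and>
     (\<forall>x\<in>I. \<forall>y\<in>I. x + y \<in> I) \<and> (\<forall>r\<in>quad_order \<Delta>. \<forall>x\<in>I. r * x \<in> I) \<and>
     (\<exists>d\<in>quad_order \<Delta>. d \<noteq> 0 \<and> (\<forall>x\<in>I. d * x \<in> quad_order \<Delta>))"

definition ideal_mult :: "complex set \<Rightarrow> complex set \<Rightarrow> complex set" where
  "ideal_mult I J = {(\<Sum>(x, y)\<leftarrow>ps. x * y) | ps. set ps \<subseteq> I \<times> J}"

definition invertible_ideal_group :: "int \<Rightarrow> complex set monoid" where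
  "invertible_ideal_group \<Delta> =
     \<lparr>carrier = {I. fractional_ideal \<Delta> I \<and>
                    (\<exists>J. fractional_ideal \<Delta> J \<and> ideal_mult I J = quad_order \<Delta>)},
      monoid.mult = ideal_mult, one = quad_order \<Delta>\<rparr>"

definition principal_ideals :: "int \<Rightarrow> complex set set" where
  "principal_ideals \<Delta> = {(*) x ` quad_order \<Delta> | x. x \<in> quad_field \<Delta> \<and> x \<noteq> 0}"

definition class_group :: "int \<Rightarrow> complex set set monoid" where
  "class_group \<Delta> = invertible_ideal_group \<Delta> Mod principal_ideals \<Delta>"

definition class_number :: "int \<Rightarrow> nat" where
  "class_number \<Delta> = Coset.order (class_group \<Delta>)"

lemma csqrt_sq [simp]: "csqrt z * csqrt z = z"
  by (metis power2_csqrt power2_eq_square)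

lemma quad_field_Rat: "of_rat a \<in> quad_field \<Delta>"
  unfolding quad_field_def by (rule CollectI, rule exI[of _ a], rule exI[of _ 0]) simp

lemma quad_field_add: "x \<in> quad_field \<Delta> \<Longrightarrow> y \<in> quad_field \<Delta> \<Longrightarrow> x + y \<in> quad_field \<Delta>"
  unfolding quad_field_def
proof clarify
  fix a b c d :: rat
  show "\<exists>e f. of_rat a + of_rat b * csqrt (of_int \<Delta>) + (of_rat c + of_rat d * csqrt (of_int \<Delta>))
      = of_rat e + of_rat f * csqrt (of_int \<Delta>) \<and> True"
    by (rule exI[of _ "a + c"], rule exI[of _ "b + d"]) (simp add: of_rat_add algebra_simps)
qed

lemma quad_field_mult: "x \<in> quad_field \<Delta> \<Longrightarrow> y \<in> quad_field \<Delta> \<Longrightarrow> x * y \<in> quad_field \<Delta>"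
  unfolding quad_field_def
proof clarify
  fix a b c d :: rat
  let ?s = "csqrt (of_int \<Delta>)"
  have "(of_rat a + of_rat b * ?s) * (of_rat c + of_rat d * ?s)
      = of_rat a * of_rat c + of_rat b * of_rat d * (?s * ?s)
        + (of_rat a * of_rat d + of_rat b * of_rat c) * ?s"
    by (simp add: algebra_simps del: csqrt_sq)
  also have "\<dots> = of_rat (a * c + b * d * of_int \<Delta>) + of_rat (a * d + b * c) * ?s"
    by (simp add: of_rat_add of_rat_mult)
  finally show "\<exists>e f. (of_rat a + of_rat b * ?s) * (of_rat c + of_rat d * ?s)
      = of_rat e + of_rat f * ?s \<and> True"
    by blast
qed

lemma quad_field_inverse:
  assumes "x \<in> quad_field \<Delta>"
  shows "inverse x \<in> quad_field \<Delta>"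
proof -
  let ?s = "csqrt (of_int \<Delta>)"
  obtain a b where x: "x = of_rat a + of_rat b * ?s"
    using assms unfolding quad_field_def by blast
  define y where "y = of_rat a + of_rat (- b) * ?s"
  have yK: "y \<in> quad_field \<Delta>" unfolding y_def quad_field_def by blast
  have "x * y = of_rat a * of_rat a - of_rat b * of_rat b * (?s * ?s)"
    by (simp add: x y_def of_rat_minus algebra_simps del: csqrt_sq)
  then have xy: "x * y = of_rat (a * a - b * b * of_int \<Delta>)"
    by (simp add: of_rat_diff of_rat_mult)
  show ?thesis
  proof (cases "y = 0")
    case True
    then have "of_rat b * ?s = of_rat a" by (simp add: y_def of_rat_minus)
    then have "x = of_rat (a + a)" unfolding x of_rat_add by simp
    then have "inverse x = of_rat (inverse (a + a))" by (simp only: of_rat_inverse)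
    then show ?thesis using quad_field_Rat by metis
  next
    case False
    then have "inverse x = y * inverse (x * y)" by simp
    also have "\<dots> = y * of_rat (inverse (a * a - b * b * of_int \<Delta>))"
      by (simp only: xy of_rat_inverse)
    finally show ?thesis using quad_field_mult[OF yK quad_field_Rat] by metis
  qed
qed

lemma of_int_poly_add:
  "map_poly of_int (p + q) = map_poly of_int p + (map_poly of_int q :: complex poly)"
  by (rule poly_eqI) (simp add: coeff_map_poly)

lemma of_int_poly_mult:
  "map_poly of_int (p * q) = map_poly of_int p * (map_poly of_int q :: complex poly)"
  by (rule poly_eqI) (simp add: coeff_map_poly coeff_mult)

lemma quad_order_add: "x \<in> quad_order \<Delta> \<Longrightarrow> y \<in> quad_order \<Delta> \<Longrightarrow> x + y \<in> quad_order \<Delta>"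
  unfolding quad_order_def by (clarify, metis of_int_poly_add poly_add)

lemma quad_order_mult: "x \<in> quad_order \<Delta> \<Longrightarrow> y \<in> quad_order \<Delta> \<Longrightarrow> x * y \<in> quad_order \<Delta>"
  unfolding quad_order_def by (clarify, metis of_int_poly_mult poly_mult)

lemma quad_order_int: "of_int a \<in> quad_order \<Delta>"
  unfolding quad_order_def by (rule CollectI, rule exI[of _ "[:a:]"]) (simp add: map_poly_pCons)

lemma quad_order_0: "0 \<in> quad_order \<Delta>" and quad_order_1: "1 \<in> quad_order \<Delta>"
  using quad_order_int[of 0] quad_order_int[of 1] by simp_all

lemma quad_gen_in_order: "quad_gen \<Delta> \<in> quad_order \<Delta>"
  unfolding quad_order_def by (rule CollectI, rule exI[of _ "[:0, 1:]"]) (simp add: map_poly_pCons)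

lemma quad_order_subset_field: "quad_order \<Delta> \<subseteq> quad_field \<Delta>"
proof
  have gen: "quad_gen \<Delta> \<in> quad_field \<Delta>"
    unfolding quad_field_def quad_gen_def
    by (rule CollectI, rule exI[of _ "of_int \<Delta> / 2"], rule exI[of _ "1 / 2"])
      (simp add: of_rat_divide field_simps)
  have "poly (map_poly of_int p) (quad_gen \<Delta>) \<in> quad_field \<Delta>" for p :: "int poly"
  proof (induction p)
    case 0
    then show ?case using quad_field_Rat[of 0] by simp
  next
    case (pCons a p)
    then show ?case
      using quad_field_add[OF quad_field_Rat[of "of_int a"] quad_field_mult[OF gen pCons.IH]]
      by (simp add: map_poly_pCons)
  qed
  then show "x \<in> quad_field \<Delta>" if "x \<in> quad_order \<Delta>" for x
    using that unfolding quad_order_def by blast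
qed

lemma quad_order_eq:
  assumes "quad_discriminant \<Delta>"
  shows "quad_order \<Delta> = {of_int a + of_int b * quad_gen \<Delta> | a b. True}"
proof
  let ?w = "quad_gen \<Delta>"
  have "(\<Delta> * \<Delta> - \<Delta>) mod 4 = 0"
  proof -
    from assms consider "\<Delta> mod 4 = 0" | "\<Delta> mod 4 = 1"
      unfolding quad_discriminant_def by blast
    then have "\<Delta> * \<Delta> mod 4 = \<Delta> mod 4"
      by cases (simp_all add: mod_mult_eq[of \<Delta> 4 \<Delta>, symmetric])
    then show ?thesis by (simp add: mod_eq_dvd_iff)
  qed
  then obtain c where c: "\<Delta> * \<Delta> - \<Delta> = 4 * c"
    by (meson dvdE mod_0_imp_dvd)
  have "4 * (?w * ?w) = 4 * (of_int \<Delta> * ?w) - (of_int \<Delta> * of_int \<Delta> - of_int \<Delta>)"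
    by (simp add: quad_gen_def field_simps)
  also have "of_int \<Delta> * of_int \<Delta> - of_int \<Delta> = (of_int (4 * c) :: complex)"
    by (simp flip: c)
  finally have "4 * (?w * ?w) = 4 * (of_int \<Delta> * ?w - of_int c)" by (simp add: algebra_simps)
  then have w2: "?w * ?w = of_int \<Delta> * ?w - of_int c"
    by (metis mult_cancel_left zero_neq_numeral)
  have "\<exists>a b. poly (map_poly of_int p) ?w = of_int a + of_int b * ?w" for p :: "int poly"
  proof (induction p)
    case 0
    show ?case by (rule exI[of _ 0], rule exI[of _ 0]) simp
  next
    case (pCons a p)
    then obtain u v where uv: "poly (map_poly of_int p) ?w = of_int u + of_int v * ?w" by blast
    have "poly (map_poly of_int (pCons a p)) ?w = of_int a + of_int u * ?w + of_int v * (?w * ?w)"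
      using uv by (simp add: map_poly_pCons algebra_simps)
    also have "\<dots> = of_int (a - v * c) + of_int (u + v * \<Delta>) * ?w"
      unfolding w2 by (simp add: algebra_simps)
    finally show ?case by blast
  qed
  then show "quad_order \<Delta> \<subseteq> {of_int a + of_int b * ?w | a b. True}"
    unfolding quad_order_def by blast
  show "{of_int a + of_int b * ?w | a b. True} \<subseteq> quad_order \<Delta>"
    using quad_order_add quad_order_mult quad_order_int quad_gen_in_order by blast
qed

lemma ideal_mult_0: "0 \<in> ideal_mult I J"
  unfolding ideal_mult_def by (rule CollectI, rule exI[of _ "[]"]) simp

lemma ideal_mult_prod: "x \<in> I \<Longrightarrow> y \<in> J \<Longrightarrow> x * y \<in> ideal_mult I J"
  unfolding ideal_mult_def by (rule CollectI, rule exI[of _ "[(x, y)]"]) simp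

lemma ideal_mult_add:
  assumes "x \<in> ideal_mult I J" "y \<in> ideal_mult I J"
  shows "x + y \<in> ideal_mult I J"
proof -
  obtain ps qs where "x = (\<Sum>(x, y)\<leftarrow>ps. x * y)" "set ps \<subseteq> I \<times> J"
    "y = (\<Sum>(x, y)\<leftarrow>qs. x * y)" "set qs \<subseteq> I \<times> J"
    using assms unfolding ideal_mult_def by blast
  then show ?thesis
    unfolding ideal_mult_def by (intro CollectI exI[of _ "ps @ qs"]) simp
qed

lemma ideal_mult_induct [consumes 1, case_names zero add]:
  assumes "z \<in> ideal_mult I J" and "P 0"
    and "\<And>x y z. x \<in> I \<Longrightarrow> y \<in> J \<Longrightarrow> P z \<Longrightarrow> P (x * y + z)"
  shows "P z"
proof -
  obtain ps where z: "z = (\<Sum>(x, y)\<leftarrow>ps. x * y)" and ps: "set ps \<subseteq> I \<times> J"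
    using assms(1) unfolding ideal_mult_def by blast
  from ps have "P (\<Sum>(x, y)\<leftarrow>ps. x * y)"
    by (induction ps) (use assms(2,3) in auto)
  with z show ?thesis by simp
qed

lemma ideal_mult_commute: "ideal_mult I J = ideal_mult J I"
proof -
  have "ideal_mult A B \<subseteq> ideal_mult B A" for A B
  proof
    fix z assume "z \<in> ideal_mult A B"
    then show "z \<in> ideal_mult B A"
    proof (induction rule: ideal_mult_induct)
      case zero
      show ?case by (rule ideal_mult_0)
    next
      case (add x y z)
      then show ?case
        using ideal_mult_add[OF ideal_mult_prod[of y B x A]] by (simp add: mult.commute)
    qed
  qed
  then show ?thesis by blast
qed

lemma ideal_mult_assoc_subset: "ideal_mult (ideal_mult I J) L \<subseteq> ideal_mult I (ideal_mult J L)"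
proof
  have *: "x * y \<in> ideal_mult I (ideal_mult J L)" if "x \<in> ideal_mult I J" "y \<in> L" for x y
    using that(1)
  proof (induction rule: ideal_mult_induct)
    case zero
    then show ?case by (simp add: ideal_mult_0)
  next
    case (add a b z)
    have "a * (b * y) \<in> ideal_mult I (ideal_mult J L)"
      using add that(2) by (intro ideal_mult_prod)
    then have "a * (b * y) + z * y \<in> ideal_mult I (ideal_mult J L)"
      using add by (intro ideal_mult_add)
    then show ?case by (simp add: algebra_simps)
  qed
  fix z assume "z \<in> ideal_mult (ideal_mult I J) L"
  then show "z \<in> ideal_mult I (ideal_mult J L)"
    by (induction rule: ideal_mult_induct) (auto intro: ideal_mult_0 ideal_mult_add *)
qed

lemma ideal_mult_assoc: "ideal_mult (ideal_mult I J) L = ideal_mult I (ideal_mult J L)"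
  using ideal_mult_assoc_subset[of I J L] ideal_mult_assoc_subset[of L J I]
  by (metis ideal_mult_commute subset_antisym)

lemma ideal_mult_one:
  assumes "fractional_ideal \<Delta> I"
  shows "ideal_mult (quad_order \<Delta>) I = I"
proof
  show "ideal_mult (quad_order \<Delta>) I \<subseteq> I"
  proof
    fix z assume "z \<in> ideal_mult (quad_order \<Delta>) I"
    then show "z \<in> I"
      by (induction rule: ideal_mult_induct) (use assms in \<open>auto simp: fractional_ideal_def\<close>)
  qed
  show "I \<subseteq> ideal_mult (quad_order \<Delta>) I"
    using ideal_mult_prod[OF quad_order_1] by fastforce
qed

lemma fractional_ideal_mult:
  assumes I: "fractional_ideal \<Delta> I" and J: "fractional_ideal \<Delta> J"
  shows "fractional_ideal \<Delta> (ideal_mult I J)"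
  unfolding fractional_ideal_def
proof (intro conjI ballI)
  show "ideal_mult I J \<subseteq> quad_field \<Delta>"
  proof
    fix z assume "z \<in> ideal_mult I J"
    then show "z \<in> quad_field \<Delta>"
    proof (induction rule: ideal_mult_induct)
      case zero
      then show ?case using quad_field_Rat[of 0] by simp
    next
      case (add x y z)
      then show ?case
        using I J by (intro quad_field_add quad_field_mult) (auto simp: fractional_ideal_def)
    qed
  qed
  show "0 \<in> ideal_mult I J" by (rule ideal_mult_0)
  have "\<exists>x\<in>A. x \<noteq> 0" if "fractional_ideal \<Delta> A" for A
    using that unfolding fractional_ideal_def by blast
  with I J obtain x y where "x \<in> I" "x \<noteq> 0" "y \<in> J" "y \<noteq> 0" by meson
  then have "x * y \<in> ideal_mult I J" "x * y \<noteq> 0" by (auto intro: ideal_mult_prod)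
  then show "ideal_mult I J \<noteq> {0}" by blast
  show "x + y \<in> ideal_mult I J" if "x \<in> ideal_mult I J" "y \<in> ideal_mult I J" for x y
    using that by (rule ideal_mult_add)
  show "r * x \<in> ideal_mult I J" if r: "r \<in> quad_order \<Delta>" and x: "x \<in> ideal_mult I J" for r x
    using x
  proof (induction rule: ideal_mult_induct)
    case zero
    then show ?case by (simp add: ideal_mult_0)
  next
    case (add a b z)
    have "r * a \<in> I" using I r add by (auto simp: fractional_ideal_def)
    then have "(r * a) * b + r * z \<in> ideal_mult I J"
      using add by (metis ideal_mult_add ideal_mult_prod)
    then show ?case by (simp add: algebra_simps)
  qed
  obtain d where d: "d \<in> quad_order \<Delta>" "d \<noteq> 0" "\<forall>x\<in>I. d * x \<in> quad_order \<Delta>"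
    using I unfolding fractional_ideal_def by meson
  obtain e where e: "e \<in> quad_order \<Delta>" "e \<noteq> 0" "\<forall>x\<in>J. e * x \<in> quad_order \<Delta>"
    using J unfolding fractional_ideal_def by meson
  have "d * e * x \<in> quad_order \<Delta>" if "x \<in> ideal_mult I J" for x
    using that
  proof (induction rule: ideal_mult_induct)
    case zero
    then show ?case by (simp add: quad_order_0)
  next
    case (add a b z)
    then have "(d * a) * (e * b) + d * e * z \<in> quad_order \<Delta>"
      using d e by (auto intro!: quad_order_add quad_order_mult[of "d * a"])
    then show ?case by (simp add: algebra_simps)
  qed
  then show "\<exists>d\<in>quad_order \<Delta>. d \<noteq> 0 \<and> (\<forall>x\<in>ideal_mult I J. d * x \<in> quad_order \<Delta>)"
    using d e quad_order_mult by (intro bexI[of _ "d * e"]) auto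
qed

lemma fractional_ideal_order: "fractional_ideal \<Delta> (quad_order \<Delta>)"
  unfolding fractional_ideal_def
proof (intro conjI ballI)
  show "quad_order \<Delta> \<noteq> {0}" using quad_order_1[of \<Delta>] by auto
  show "\<exists>d\<in>quad_order \<Delta>. d \<noteq> 0 \<and> (\<forall>x\<in>quad_order \<Delta>. d * x \<in> quad_order \<Delta>)"
    using quad_order_1[of \<Delta>] by (intro bexI[of _ 1]) auto
qed (use quad_order_subset_field in \<open>auto simp: quad_order_0 quad_order_add quad_order_mult\<close>)

lemma comm_group_invertible_ideals: "comm_group (invertible_ideal_group \<Delta>)"
proof (rule comm_groupI)
  fix I J L
  let ?G = "invertible_ideal_group \<Delta>"
  show "I \<otimes>\<^bsub>?G\<^esub> J \<in> carrier ?G" if IJ: "I \<in> carrier ?G" "J \<in> carrier ?G"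
  proof -
    obtain I' J' where *: "fractional_ideal \<Delta> I'" "ideal_mult I I' = quad_order \<Delta>"
      "fractional_ideal \<Delta> J'" "ideal_mult J J' = quad_order \<Delta>"
      using IJ unfolding invertible_ideal_group_def by auto
    have "ideal_mult (ideal_mult I J) (ideal_mult J' I') = ideal_mult I (ideal_mult (ideal_mult J J') I')"
      by (simp add: ideal_mult_assoc)
    also have "\<dots> = quad_order \<Delta>" by (simp add: * ideal_mult_one)
    finally show ?thesis
      using IJ * by (auto simp: invertible_ideal_group_def intro: fractional_ideal_mult)
  qed
  show "\<one>\<^bsub>?G\<^esub> \<in> carrier ?G"
    using fractional_ideal_order ideal_mult_one[OF fractional_ideal_order]
    by (auto simp: invertible_ideal_group_def)
  show "I \<otimes>\<^bsub>?G\<^esub> J \<otimes>\<^bsub>?G\<^esub> L = I \<otimes>\<^bsub>?G\<^esub> (J \<otimes>\<^bsub>?G\<^esub> L)"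
    by (simp add: invertible_ideal_group_def ideal_mult_assoc)
  show "I \<otimes>\<^bsub>?G\<^esub> J = J \<otimes>\<^bsub>?G\<^esub> I"
    by (simp add: invertible_ideal_group_def ideal_mult_commute[of I])
  show "\<one>\<^bsub>?G\<^esub> \<otimes>\<^bsub>?G\<^esub> I = I" if "I \<in> carrier ?G"
    using that by (simp add: invertible_ideal_group_def ideal_mult_one)
  show "\<exists>J\<in>carrier ?G. J \<otimes>\<^bsub>?G\<^esub> I = \<one>\<^bsub>?G\<^esub>" if "I \<in> carrier ?G"
    using that ideal_mult_commute by (auto simp: invertible_ideal_group_def)
qed

lemma ideal_mult_principal:
  "ideal_mult ((*) x ` quad_order \<Delta>) ((*) y ` quad_order \<Delta>) = (*) (x * y) ` quad_order \<Delta>"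
proof
  show "ideal_mult ((*) x ` quad_order \<Delta>) ((*) y ` quad_order \<Delta>) \<subseteq> (*) (x * y) ` quad_order \<Delta>"
  proof
    fix z assume "z \<in> ideal_mult ((*) x ` quad_order \<Delta>) ((*) y ` quad_order \<Delta>)"
    then show "z \<in> (*) (x * y) ` quad_order \<Delta>"
    proof (induction rule: ideal_mult_induct)
      case zero
      show ?case by (rule image_eqI[of _ _ 0]) (simp_all add: quad_order_0)
    next
      case (add a b z)
      then obtain r s t where "a = x * r" "b = y * s" "z = x * y * t"
        and rst: "r \<in> quad_order \<Delta>" "s \<in> quad_order \<Delta>" "t \<in> quad_order \<Delta>" by blast
      then have "a * b + z = x * y * (r * s + t)" by (simp add: algebra_simps)
      then show ?case using rst quad_order_add quad_order_mult by blast
    qed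
  qed
  show "(*) (x * y) ` quad_order \<Delta> \<subseteq> ideal_mult ((*) x ` quad_order \<Delta>) ((*) y ` quad_order \<Delta>)"
  proof clarify
    fix r assume "r \<in> quad_order \<Delta>"
    then have "(x * r) * (y * 1) \<in> ideal_mult ((*) x ` quad_order \<Delta>) ((*) y ` quad_order \<Delta>)"
      using quad_order_1 by (intro ideal_mult_prod) blast+
    then show "x * y * r \<in> ideal_mult ((*) x ` quad_order \<Delta>) ((*) y ` quad_order \<Delta>)"
      by (simp add: algebra_simps)
  qed
qed

lemma quad_field_denom:
  assumes "x \<in> quad_field \<Delta>"
  shows "\<exists>d\<in>quad_order \<Delta>. d \<noteq> 0 \<and> d * x \<in> quad_order \<Delta>"
proof -
  obtain a b where x: "x = of_rat a + of_rat b * csqrt (of_int \<Delta>)"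
    using assms unfolding quad_field_def by blast
  obtain p q where a: "a = of_int p / of_int q" "q \<noteq> 0"
    by (metis Fract_of_int_quotient Rat_cases less_irrefl)
  obtain r s where b: "b = of_int r / of_int s" "s \<noteq> 0"
    by (metis Fract_of_int_quotient Rat_cases less_irrefl)
  have sq: "csqrt (of_int \<Delta>) = of_int 2 * quad_gen \<Delta> + of_int (- \<Delta>)"
    by (simp add: quad_gen_def field_simps)
  have "of_int (q * s) * x = of_int (p * s) + of_int (r * q) * csqrt (of_int \<Delta>)"
    using a(2) b(2) by (simp add: x a(1) b(1) of_rat_divide field_simps)
  also have "\<dots> \<in> quad_order \<Delta>"
    unfolding sq by (intro quad_order_add quad_order_mult quad_order_int quad_gen_in_order)
  finally show ?thesis
    using a b quad_order_int[of "q * s" \<Delta>] by (intro bexI[of _ "of_int (q * s)"]) auto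
qed

lemma fractional_ideal_principal:
  assumes x: "x \<in> quad_field \<Delta>" "x \<noteq> 0"
  shows "fractional_ideal \<Delta> ((*) x ` quad_order \<Delta>)"
  unfolding fractional_ideal_def
proof (intro conjI ballI)
  let ?I = "(*) x ` quad_order \<Delta>"
  show "?I \<subseteq> quad_field \<Delta>"
    using x quad_order_subset_field by (auto intro: quad_field_mult)
  show "0 \<in> ?I" by (rule image_eqI[of _ _ 0]) (simp_all add: quad_order_0)
  have "x * 1 \<in> ?I" using quad_order_1 by blast
  with x show "?I \<noteq> {0}" by auto
  show "y + z \<in> ?I" if "y \<in> ?I" "z \<in> ?I" for y z
    using that by (auto simp: quad_order_add simp flip: distrib_left)
  show "r * y \<in> ?I" if "r \<in> quad_order \<Delta>" "y \<in> ?I" for r y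
    using that by (auto simp: quad_order_mult mult.left_commute)
  obtain d where d: "d \<in> quad_order \<Delta>" "d \<noteq> 0" "d * x \<in> quad_order \<Delta>"
    using quad_field_denom[OF x(1)] by blast
  then show "\<exists>d\<in>quad_order \<Delta>. d \<noteq> 0 \<and> (\<forall>y\<in>?I. d * y \<in> quad_order \<Delta>)"
    by (intro bexI[of _ d]) (auto simp: quad_order_mult simp flip: mult.assoc)
qed

lemma subgroup_principal_ideals:
  "subgroup (principal_ideals \<Delta>) (invertible_ideal_group \<Delta>)"
proof -
  let ?G = "invertible_ideal_group \<Delta>" and ?O = "quad_order \<Delta>"
  interpret comm_group ?G by (rule comm_group_invertible_ideals)
  have inv_mult: "ideal_mult ((*) x ` ?O) ((*) (inverse x) ` ?O) = ?O" if "x \<noteq> 0" for x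
    using that by (simp add: ideal_mult_principal)
  have carrier: "(*) x ` ?O \<in> carrier ?G" if "x \<in> quad_field \<Delta>" "x \<noteq> 0" for x
    using that fractional_ideal_principal[of x \<Delta>] fractional_ideal_principal[of "inverse x" \<Delta>]
      inv_mult[of x] by (auto simp: invertible_ideal_group_def quad_field_inverse)
  show ?thesis
  proof (rule subgroupI)
    show "principal_ideals \<Delta> \<subseteq> carrier ?G"
      unfolding principal_ideals_def using carrier by blast
    show "principal_ideals \<Delta> \<noteq> {}"
      using quad_field_Rat[of 1 \<Delta>] unfolding principal_ideals_def by auto
    show "inv\<^bsub>?G\<^esub> I \<in> principal_ideals \<Delta>" if I: "I \<in> principal_ideals \<Delta>" for I
    proof -
      obtain x where x: "I = (*) x ` ?O" "x \<in> quad_field \<Delta>" "x \<noteq> 0"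
        using I unfolding principal_ideals_def by blast
      have "inv\<^bsub>?G\<^esub> I = (*) (inverse x) ` ?O"
      proof (rule inv_equality)
        show "I \<in> carrier ?G" "(*) (inverse x) ` ?O \<in> carrier ?G"
          using x carrier quad_field_inverse by simp_all
        show "(*) (inverse x) ` ?O \<otimes>\<^bsub>?G\<^esub> I = \<one>\<^bsub>?G\<^esub>"
          using x by (simp add: invertible_ideal_group_def ideal_mult_principal)
      qed
      then show ?thesis
        using x unfolding principal_ideals_def
        by (auto intro!: exI[of _ "inverse x"] quad_field_inverse)
    qed
    show "I \<otimes>\<^bsub>?G\<^esub> J \<in> principal_ideals \<Delta>"
      if IJ: "I \<in> principal_ideals \<Delta>" "J \<in> principal_ideals \<Delta>" for I J
    proof -
      obtain x where x: "I = (*) x ` ?O" "x \<in> quad_field \<Delta>" "x \<noteq> 0"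
        using IJ(1) unfolding principal_ideals_def by blast
      obtain y where y: "J = (*) y ` ?O" "y \<in> quad_field \<Delta>" "y \<noteq> 0"
        using IJ(2) unfolding principal_ideals_def by blast
      from x y have "I \<otimes>\<^bsub>?G\<^esub> J = (*) (x * y) ` ?O" "x * y \<in> quad_field \<Delta>" "x * y \<noteq> 0"
        by (auto simp: invertible_ideal_group_def ideal_mult_principal quad_field_mult)
      then show ?thesis unfolding principal_ideals_def by blast
    qed
  qed
qed

lemma comm_group_class_group: "comm_group (class_group \<Delta>)"
  unfolding class_group_def
  by (rule comm_group.abelian_FactGroup[OF comm_group_invertible_ideals subgroup_principal_ideals])

end

theory Submission
  imports Defs "HOL-Algebra.Multiplicative_Group"
begin

text \<open>
  Scaling an ideal by an element of least absolute norm yields an ideal \<open>J\<close> with \<open>1 \<in> J\<close> all of whose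
  nonzero elements have norm at least \<open>1\<close> in absolute value. Then \<open>J \<inter> \<rat> = \<int>\<close>, so
  \<open>J = \<int> + \<int>(w - j)/k\<close> with \<open>w = (\<Delta> + \<surd>\<Delta>)/2\<close>, \<open>3k\<^sup>2 \<le> \<bar>\<Delta>\<bar>\<close> and \<open>\<bar>\<Delta> - 2j\<bar> \<le> k\<close>. Hence the class
  group is finite, and for \<open>\<Delta> = 32\<close> the only such \<open>J\<close> that is invertible is the order itself.

  For \<open>n = 2m\<close> the order is \<open>\<int>[\<surd>D]\<close> with \<open>D = m\<^sup>2 - 1\<close>. If \<open>m\<close> is even, the ideal \<open>(2, 1 + \<surd>D)\<close> has
  square \<open>(2)\<close>, and a generator would solve \<open>x\<^sup>2 - D y\<^sup>2 = \<plusminus>2\<close>, impossible for \<open>m \<ge> 3\<close> by descent along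
  the unit \<open>m + \<surd>D\<close>. If \<open>m = 2k + 1\<close> is odd, the order is contained in \<open>\<int>[\<surd>D / 2]\<close> and hence not maximal;
  the ideal \<open>(4, 2 + \<surd>D)\<close> has square \<open>(4)\<close>, and a generator would give a solution of
  \<open>x\<^sup>2 - k(k + 1) y\<^sup>2 = \<plusminus>1\<close> with \<open>y\<close> odd, again excluded by descent for \<open>k \<ge> 2\<close>. So this ideal represents a
  class of order \<open>2\<close>.
\<close>

section \<open>Coordinates and norm in the quadratic field\<close>

text \<open>If \<open>b \<noteq> d\<close>, then \<surd>\<Delta> would be rational. A rational
  square root of an integer is an integer, so \<Delta> would be a square.\<close>

lemma quad_coords_unique:
  assumes "quad_discriminant \<Delta>"
    and eq: "of_rat a + of_rat b * csqrt (of_int \<Delta>) = of_rat c + of_rat d * csqrt (of_int \<Delta>)"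
  shows "a = c \<and> b = d"
proof (cases "b = d")
  case True
  with eq show ?thesis by simp
next
  case False
  define r where "r = (c - a) / (b - d)"
  have "of_rat (b - d) * csqrt (of_int \<Delta>) = (of_rat (c - a) :: complex)"
    using eq by (simp add: of_rat_diff algebra_simps)
  then have "csqrt (of_int \<Delta>) = of_rat r"
    using False by (simp add: r_def of_rat_divide eq_divide_eq mult.commute)
  then have "of_int \<Delta> = (of_rat (r * r) :: complex)"
    by (metis csqrt_sq of_rat_mult)
  then have r2: "r * r = of_int \<Delta>"
    by (metis of_rat_eq_iff of_rat_of_int_eq)
  obtain p q where pq: "r = of_int p / of_int q" "q \<noteq> 0"
    by (metis Fract_of_int_quotient Rat_cases less_irrefl)
  have "(of_int (p * p) :: rat) = of_int (\<Delta> * (q * q))"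
    using r2 pq by (simp add: field_simps)
  then have "p * p = \<Delta> * (q * q)"
    by (simp only: of_int_eq_iff)
  then have p2: "p\<^sup>2 = \<Delta> * q\<^sup>2" by (simp add: power2_eq_square)
  then have "q\<^sup>2 dvd p\<^sup>2" by simp
  then have "q dvd p" by simp
  then obtain t where "p = q * t" by blast
  with p2 pq have "\<Delta> = t\<^sup>2" by (simp add: power_mult_distrib)
  with assms show ?thesis by (auto simp: quad_discriminant_def)
qed

lemma quad_fieldE:
  assumes "z \<in> quad_field \<Delta>"
  obtains a b where "z = of_rat a + of_rat b * csqrt (of_int \<Delta>)"
  using assms unfolding quad_field_def by blast

text \<open>The field norm. Elements are bare complex numbers, and for \<Delta> > 0 the conjugation
  of the field is not complex conjugation, so the norm is read off the coordinates;
  \<open>quad_coords_unique\<close> makes the value well defined.\<close>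

definition quad_norm :: "int \<Rightarrow> complex \<Rightarrow> rat" where
  "quad_norm \<Delta> z =
     (THE q. \<exists>a b. z = of_rat a + of_rat b * csqrt (of_int \<Delta>) \<and> q = a\<^sup>2 - of_int \<Delta> * b\<^sup>2)"

lemma quad_norm_coords:
  assumes "quad_discriminant \<Delta>"
  shows "quad_norm \<Delta> (of_rat a + of_rat b * csqrt (of_int \<Delta>)) = a\<^sup>2 - of_int \<Delta> * b\<^sup>2"
  unfolding quad_norm_def using quad_coords_unique[OF assms] by (intro the_equality) blast+

lemma quad_norm_of_rat:
  assumes "quad_discriminant \<Delta>"
  shows "quad_norm \<Delta> (of_rat r) = r\<^sup>2"
  using quad_norm_coords[OF assms, of r 0] by simp

lemma quad_norm_mult:
  assumes "quad_discriminant \<Delta>" "x \<in> quad_field \<Delta>" "y \<in> quad_field \<Delta>"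
  shows "quad_norm \<Delta> (x * y) = quad_norm \<Delta> x * quad_norm \<Delta> y"
proof -
  let ?s = "csqrt (of_int \<Delta>)"
  obtain a b c d where x: "x = of_rat a + of_rat b * ?s" and y: "y = of_rat c + of_rat d * ?s"
    using assms by (metis quad_fieldE)
  have "x * y = of_rat a * of_rat c + of_rat b * of_rat d * (?s * ?s)
        + (of_rat a * of_rat d + of_rat b * of_rat c) * ?s"
    by (simp add: x y algebra_simps del: csqrt_sq)
  also have "\<dots> = of_rat (a * c + b * d * of_int \<Delta>) + of_rat (a * d + b * c) * ?s"
    by (simp add: of_rat_add of_rat_mult)
  finally have "quad_norm \<Delta> (x * y) = (a * c + b * d * of_int \<Delta>)\<^sup>2 - of_int \<Delta> * (a * d + b * c)\<^sup>2"
    using quad_norm_coords[OF assms(1)] by metis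
  then show ?thesis
    unfolding x y quad_norm_coords[OF assms(1)] by (simp add: power2_eq_square algebra_simps)
qed

lemma quad_norm_nonzero:
  assumes "quad_discriminant \<Delta>" "x \<in> quad_field \<Delta>" "x \<noteq> 0"
  shows "quad_norm \<Delta> x \<noteq> 0"
proof -
  have "quad_norm \<Delta> x * quad_norm \<Delta> (inverse x) = quad_norm \<Delta> (of_rat 1)"
    using assms quad_norm_mult[OF assms(1,2) quad_field_inverse[OF assms(2)]] by simp
  then show ?thesis using quad_norm_of_rat[OF assms(1), of 1] by auto
qed

lemma quad_gen_coords:
  "of_int a + of_int b * quad_gen \<Delta>
     = of_rat (of_int (2 * a + b * \<Delta>) / 2) + of_rat (of_int b / 2) * csqrt (of_int \<Delta>)"
  by (simp add: quad_gen_def of_rat_divide of_rat_add of_rat_diff of_rat_mult field_simps)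

text \<open>The norm of \<open>a + b * w\<close> with \<open>w = quad_gen \<Delta>\<close> is
  \<open>a\<^sup>2 + a * b * \<Delta> + b\<^sup>2 * (\<Delta>\<^sup>2 - \<Delta>) / 4\<close>,
  integral because \<Delta> is 0 or 1 mod 4.\<close>

lemma quad_norm_order:
  assumes "quad_discriminant \<Delta>" "z \<in> quad_order \<Delta>"
  shows "\<exists>k. quad_norm \<Delta> z = of_int k"
proof -
  obtain a b where z: "z = of_int a + of_int b * quad_gen \<Delta>"
    using assms unfolding quad_order_eq[OF assms(1)] by blast
  have "4 dvd \<Delta> * \<Delta> - \<Delta>"
  proof -
    from assms consider "\<Delta> mod 4 = 0" | "\<Delta> mod 4 = 1"
      unfolding quad_discriminant_def by blast
    then have "\<Delta> * \<Delta> mod 4 = \<Delta> mod 4"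
      by cases (simp_all add: mod_mult_eq[of \<Delta> 4 \<Delta>, symmetric])
    then show ?thesis by (simp add: mod_eq_dvd_iff)
  qed
  then obtain c where c: "\<Delta> * \<Delta> - \<Delta> = 4 * c" by blast
  have "quad_norm \<Delta> z = of_int a * of_int a + of_int a * of_int b * of_int \<Delta>
      + of_int b * of_int b * of_int (\<Delta> * \<Delta> - \<Delta>) / 4"
    unfolding z quad_gen_coords quad_norm_coords[OF assms(1)]
    by (simp add: power2_eq_square field_simps)
  also have "\<dots> = of_int (a * a + a * b * \<Delta> + b * b * c)"
    unfolding c by simp
  finally show ?thesis by blast
qed

section \<open>Reduction of fractional ideals\<close>

lemma fractional_ideal_field: "fractional_ideal \<Delta> I \<Longrightarrow> x \<in> I \<Longrightarrow> x \<in> quad_field \<Delta>"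
  and fractional_ideal_add: "fractional_ideal \<Delta> I \<Longrightarrow> x \<in> I \<Longrightarrow> y \<in> I \<Longrightarrow> x + y \<in> I"
  and fractional_ideal_scale:
    "fractional_ideal \<Delta> I \<Longrightarrow> r \<in> quad_order \<Delta> \<Longrightarrow> x \<in> I \<Longrightarrow> r * x \<in> I"
  unfolding fractional_ideal_def by blast+

lemma fractional_ideal_int: "fractional_ideal \<Delta> I \<Longrightarrow> x \<in> I \<Longrightarrow> of_int a * x \<in> I"
  by (rule fractional_ideal_scale[OF _ quad_order_int])

lemma fractional_ideal_diff:
  assumes "fractional_ideal \<Delta> I" "x \<in> I" "y \<in> I"
  shows "x - y \<in> I"
  using fractional_ideal_add[OF assms(1,2) fractional_ideal_int[OF assms(1,3), of "-1"]] by simp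

text \<open>A common denominator \<open>d\<close> moves \<open>I\<close> into the order, where norms
  are integers. Scaling absolute norms on \<open>I\<close> by that of \<open>d\<close> thus gives
  natural numbers, and well-ordering yields a minimum.\<close>

lemma fractional_ideal_least_norm:
  assumes \<Delta>: "quad_discriminant \<Delta>" and I: "fractional_ideal \<Delta> I"
  obtains \<alpha> where "\<alpha> \<in> I" "\<alpha> \<noteq> 0"
    "\<And>z. z \<in> I \<Longrightarrow> z \<noteq> 0 \<Longrightarrow> \<bar>quad_norm \<Delta> \<alpha>\<bar> \<le> \<bar>quad_norm \<Delta> z\<bar>"
proof -
  obtain d where d: "d \<in> quad_order \<Delta>" "d \<noteq> 0" "\<forall>x\<in>I. d * x \<in> quad_order \<Delta>"
    using I unfolding fractional_ideal_def by meson
  have dK: "d \<in> quad_field \<Delta>" using d quad_order_subset_field by blast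
  \<comment> \<open>On \<open>I\<close> the norm of \<open>d * z\<close> is already an integer, so
    the floor only changes its type.\<close>
  define f where "f z = nat \<bar>\<lfloor>quad_norm \<Delta> (d * z)\<rfloor>\<bar>" for z
  have f: "\<bar>quad_norm \<Delta> d\<bar> * \<bar>quad_norm \<Delta> z\<bar> = of_nat (f z)" if z: "z \<in> I" for z
  proof -
    obtain k where k: "quad_norm \<Delta> (d * z) = of_int k"
      using quad_norm_order[OF \<Delta>] d z by blast
    then have "\<bar>quad_norm \<Delta> d\<bar> * \<bar>quad_norm \<Delta> z\<bar> = of_int \<bar>k\<bar>"
      using quad_norm_mult[OF \<Delta> dK fractional_ideal_field[OF I z]] by (simp flip: abs_mult)
    then show ?thesis using k by (simp add: f_def)
  qed
  have "\<exists>x\<in>I. x \<noteq> 0" using I unfolding fractional_ideal_def by blast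
  then obtain \<alpha> where \<alpha>: "\<alpha> \<in> I \<and> \<alpha> \<noteq> 0" "\<forall>z. z \<in> I \<and> z \<noteq> 0 \<longrightarrow> f \<alpha> \<le> f z"
    using ex_has_least_nat[of "\<lambda>z. z \<in> I \<and> z \<noteq> 0" _ f] by blast
  have "\<bar>quad_norm \<Delta> \<alpha>\<bar> \<le> \<bar>quad_norm \<Delta> z\<bar>" if "z \<in> I" "z \<noteq> 0" for z
  proof -
    have "\<bar>quad_norm \<Delta> d\<bar> * \<bar>quad_norm \<Delta> \<alpha>\<bar> \<le> \<bar>quad_norm \<Delta> d\<bar> * \<bar>quad_norm \<Delta> z\<bar>"
      using f \<alpha> that by simp
    then show ?thesis
      using quad_norm_nonzero[OF \<Delta> dK d(2)] by simp
  qed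
  then show thesis using \<alpha> that by blast
qed

text \<open>Elements \<open>(w - j) / k\<close> of \<open>J\<close> have bounded \<open>k\<close>,
  since their norms are at least 1 in absolute value. Maximality of \<open>k\<close> makes
  \<open>1\<close> and such an element a basis of \<open>J\<close>.\<close>

lemma reduced_ideal_basis:
  assumes \<Delta>: "quad_discriminant \<Delta>" and J: "fractional_ideal \<Delta> J" and "1 \<in> J"
    and min: "\<And>z. z \<in> J \<Longrightarrow> z \<noteq> 0 \<Longrightarrow> 1 \<le> \<bar>quad_norm \<Delta> z\<bar>"
  obtains k j where "k > 0" "3 * k\<^sup>2 \<le> \<bar>\<Delta>\<bar>" "\<bar>\<Delta> - 2 * j\<bar> \<le> k" "4 * k dvd (\<Delta> - 2 * j)\<^sup>2 - \<Delta>"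
    "J = {of_int a + of_int b * ((quad_gen \<Delta> - of_int j) / of_int k) | a b. True}"
proof -
  let ?w = "quad_gen \<Delta>" and ?s = "csqrt (of_int \<Delta>)"
  have int: "of_int a \<in> J" for a
    using fractional_ideal_int[OF J \<open>1 \<in> J\<close>, of a] by simp
  have w: "?w \<in> J"
    using fractional_ideal_scale[OF J quad_gen_in_order \<open>1 \<in> J\<close>] by simp
  \<comment> \<open>Subtracting the nearest integer leaves a rational of norm at most 1/4, which
    \<open>min\<close> forces to vanish.\<close>
  have rat: "\<exists>a. r = of_int a" if r: "of_rat r \<in> J" for r
  proof -
    have "of_rat (r - of_int (round r)) \<in> J"
      using fractional_ideal_diff[OF J r int] by (simp add: of_rat_diff)
    moreover have "\<bar>r - of_int (round r)\<bar> \<le> 1 / 2"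
      using of_int_round_abs_le[of r] by (simp add: abs_minus_commute)
    then have "\<bar>r - of_int (round r)\<bar>\<^sup>2 \<le> (1 / 2)\<^sup>2" by (intro power_mono) auto
    then have "\<not> 1 \<le> \<bar>quad_norm \<Delta> (of_rat (r - of_int (round r)))\<bar>"
      unfolding quad_norm_of_rat[OF \<Delta>] by (simp add: power2_eq_square)
    ultimately have "r - of_int (round r) = 0" using min by fastforce
    then show ?thesis by auto
  qed
  define T where "T k j = (?w - of_int j) / of_int k" for k j
  have T_coords: "T k j = of_rat (of_int (\<Delta> - 2 * j) / of_int (2 * k)) + of_rat (1 / of_int (2 * k)) * ?s"
    if "k \<noteq> 0" for k j
    using that by (simp add: T_def quad_gen_def of_rat_divide of_rat_add of_rat_diff of_rat_mult field_simps)
  have norm_T: "quad_norm \<Delta> (T k j) * (4 * of_int k ^ 2) = of_int ((\<Delta> - 2 * j)\<^sup>2 - \<Delta>)"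
    if "k \<noteq> 0" for k j
    using that unfolding T_coords[OF that] quad_norm_coords[OF \<Delta>]
    by (simp add: field_simps power2_eq_square)
  have T_nz: "T k j \<noteq> 0" if "k \<noteq> 0" for k j
  proof
    assume "T k j = 0"
    then have "of_rat (of_int (\<Delta> - 2 * j) / of_int (2 * k)) + of_rat (1 / of_int (2 * k)) * ?s
       = of_rat 0 + of_rat 0 * ?s"
      using T_coords[OF that] by simp
    from quad_coords_unique[OF \<Delta> this] that show False by simp
  qed
  have bound: "\<exists>j'. T k j' \<in> J \<and> \<bar>\<Delta> - 2 * j'\<bar> \<le> k \<and> 3 * k\<^sup>2 \<le> \<bar>\<Delta>\<bar>" if k: "k > 0" "T k j \<in> J" for k j
  proof -
    \<comment> \<open>\<open>t\<close> rounds \<open>(\<Delta> - 2 * j) / (2 * k)\<close> to a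
      nearest integer, so the shift brings \<open>\<Delta> - 2 * j'\<close> into the range from
      \<open>- k\<close> to \<open>k\<close>. The norm bound then reads
      \<open>4 * k\<^sup>2 \<le> k\<^sup>2 + \<bar>\<Delta>\<bar>\<close>.\<close>
    define t where "t = (\<Delta> - 2 * j + k) div (2 * k)"
    define j' where "j' = j + k * t"
    have "T k j' = T k j - of_int t"
      using k by (simp add: T_def j'_def field_simps)
    then have T: "T k j' \<in> J" using fractional_ideal_diff[OF J k(2) int] by simp
    have "\<Delta> - 2 * j + k = 2 * k * t + (\<Delta> - 2 * j + k) mod (2 * k)"
      unfolding t_def by simp
    moreover have "0 \<le> (\<Delta> - 2 * j + k) mod (2 * k)" "(\<Delta> - 2 * j + k) mod (2 * k) < 2 * k"
      using k by simp_all
    ultimately have j': "\<bar>\<Delta> - 2 * j'\<bar> \<le> k" unfolding j'_def by (simp add: algebra_simps)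
    then have "\<bar>\<Delta> - 2 * j'\<bar>\<^sup>2 \<le> k\<^sup>2" by (intro power_mono) auto
    then have sq: "(\<Delta> - 2 * j')\<^sup>2 \<le> k\<^sup>2" by simp
    have "1 \<le> \<bar>quad_norm \<Delta> (T k j')\<bar>" using min T T_nz k by simp
    then have "1 * (4 * of_int k ^ 2) \<le> \<bar>quad_norm \<Delta> (T k j')\<bar> * (4 * of_int k ^ 2)"
      by (intro mult_right_mono) auto
    also have "\<dots> = \<bar>quad_norm \<Delta> (T k j') * (4 * of_int k ^ 2)\<bar>" by (simp add: abs_mult)
    also have "\<dots> = of_int \<bar>(\<Delta> - 2 * j')\<^sup>2 - \<Delta>\<bar>" using norm_T[of k j'] k by simp
    finally have "of_int (4 * k\<^sup>2) \<le> (of_int \<bar>(\<Delta> - 2 * j')\<^sup>2 - \<Delta>\<bar> :: rat)" by simp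
    then have "4 * k\<^sup>2 \<le> \<bar>(\<Delta> - 2 * j')\<^sup>2 - \<Delta>\<bar>" by (simp only: of_int_le_iff)
    then have "3 * k\<^sup>2 \<le> \<bar>\<Delta>\<bar>" using sq zero_le_power2[of "\<Delta> - 2 * j'"] by linarith
    with T j' show ?thesis by blast
  qed
  define K where "K = {k. k > 0 \<and> (\<exists>j. T k j \<in> J)}"
  have "K \<subseteq> {0..\<bar>\<Delta>\<bar>}"
  proof
    fix k assume "k \<in> K"
    then have k: "k > 0" "3 * k\<^sup>2 \<le> \<bar>\<Delta>\<bar>" using bound unfolding K_def by blast+
    then have "k * 1 \<le> k * k" by (intro mult_left_mono) auto
    with k have "k \<le> \<bar>\<Delta>\<bar>" unfolding power2_eq_square mult_1_right by linarith
    with k show "k \<in> {0..\<bar>\<Delta>\<bar>}" by simp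
  qed
  then have "finite K" by (rule finite_subset) simp
  have "T 1 0 \<in> J" using w by (simp add: T_def)
  then have "1 \<in> K" unfolding K_def using zero_less_one by blast
  define k where "k = Max K"
  have kK: "k \<in> K" and k_max: "\<And>k'. k' \<in> K \<Longrightarrow> k' \<le> k"
    using \<open>finite K\<close> \<open>1 \<in> K\<close> unfolding k_def by (auto intro: Max_in)
  then obtain j where k: "k > 0" "3 * k\<^sup>2 \<le> \<bar>\<Delta>\<bar>" and j: "\<bar>\<Delta> - 2 * j\<bar> \<le> k" and T: "T k j \<in> J"
    using bound unfolding K_def by blast
  have "4 * k dvd (\<Delta> - 2 * j)\<^sup>2 - \<Delta>"
  proof -
    \<comment> \<open>This factor is the conjugate of \<open>w - j\<close>. Its product with
      \<open>T k j\<close> is the norm of \<open>w - j\<close> divided by \<open>k\<close>, a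
      rational element of \<open>J\<close> and hence an integer.\<close>
    have "of_int (\<Delta> - j) + of_int (- 1) * ?w \<in> quad_order \<Delta>"
      by (intro quad_order_add quad_order_mult quad_order_int quad_gen_in_order)
    then have "(of_int (\<Delta> - j) + of_int (- 1) * ?w) * T k j \<in> J"
      using T fractional_ideal_scale[OF J] by blast
    also have "(of_int (\<Delta> - j) + of_int (- 1) * ?w) * T k j
        = of_rat (of_int ((\<Delta> - 2 * j)\<^sup>2 - \<Delta>) / of_int (4 * k))"
      using k by (simp add: T_def quad_gen_def of_rat_divide of_rat_add of_rat_diff of_rat_mult field_simps power2_eq_square)
    finally obtain a where "of_int ((\<Delta> - 2 * j)\<^sup>2 - \<Delta>) / of_int (4 * k) = (of_int a :: rat)"
      using rat by blast
    then have "of_int ((\<Delta> - 2 * j)\<^sup>2 - \<Delta>) = (of_int (4 * k * a) :: rat)"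
      using k by (simp add: field_simps)
    then have "(\<Delta> - 2 * j)\<^sup>2 - \<Delta> = 4 * k * a" by (simp only: of_int_eq_iff)
    then show ?thesis by simp
  qed
  moreover have "J = {of_int a + of_int b * T k j | a b. True}"
  proof
    show "{of_int a + of_int b * T k j | a b. True} \<subseteq> J"
      using fractional_ideal_add[OF J int fractional_ideal_int[OF J T]] by blast
    show "J \<subseteq> {of_int a + of_int b * T k j | a b. True}"
    proof
      fix z assume z: "z \<in> J"
      obtain x y where xy: "z = of_rat x + of_rat y * ?s"
        using fractional_ideal_field[OF J z] by (rule quad_fieldE)
      \<comment> \<open>\<open>p / q\<close> is the irrational coordinate of \<open>z\<close>, in
        lowest terms, measured in units of that of \<open>T k j\<close>, which is
        \<open>1 / (2 * k)\<close>.\<close>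
      obtain p q where pq: "y * of_int (2 * k) = of_int p / of_int q" "q > 0" "coprime p q"
        by (metis Fract_of_int_quotient Rat_cases)
      obtain u v where uv: "u * p + v * q = 1"
        using pq(3) by (metis coprime_imp_gcd_eq_1 bezout_int)
      text \<open>The combination \<open>u z + v T\<close> has irrational part \<open>1 / q\<close> times that of \<open>T\<close>;
        maximality of \<open>k\<close> forces \<open>q = 1\<close>.\<close>
      define \<xi> where "\<xi> = of_int u * z + of_int v * T k j"
      have \<xi>: "\<xi> \<in> J"
        unfolding \<xi>_def using fractional_ideal_add[OF J] fractional_ideal_int[OF J] z T by blast
      have "of_int (k * q) * y * 2 = (of_int p :: rat)"
        using pq k by (simp add: field_simps)
      then have y: "y = of_int p / of_int (2 * k * q)" using pq k by (simp add: field_simps)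
      \<comment> \<open>\<open>k * q * \<xi>\<close> and \<open>w\<close> have the same irrational
        coordinate, so they differ by the rational \<open>r\<close>, an integer by
        \<open>rat\<close>. Hence \<xi> is some \<open>T (k * q) (- i)\<close> and
        \<open>k * q\<close> lies in \<open>K\<close>.\<close>
      define r where "r = of_int (k * q * u) * x + of_int q * of_int v * of_int (\<Delta> - 2 * j) / 2 - of_int \<Delta> / 2"
      have "of_int (k * q) * \<xi> - ?w = of_rat r + of_rat ((of_int (u * p + v * q) - 1) / 2) * ?s"
        using k pq(2) unfolding \<xi>_def xy y T_def quad_gen_def r_def
        by (simp add: of_rat_divide of_rat_add of_rat_diff of_rat_mult field_simps)
      then have "of_int (k * q) * \<xi> - ?w = of_rat r" unfolding uv by simp
      moreover have "of_int (k * q) * \<xi> - ?w \<in> J"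
        using fractional_ideal_diff[OF J fractional_ideal_int[OF J \<xi>] w] by blast
      ultimately obtain i where "of_int (k * q) * \<xi> - ?w = of_int i"
        using rat by fastforce
      then have "of_int (k * q) * \<xi> = ?w - of_int (- i)" by (simp add: algebra_simps)
      then have "T (k * q) (- i) = \<xi>"
        using k pq(2) by (simp add: T_def divide_eq_eq mult.commute)
      with \<xi> have "k * q \<in> K" using k pq(2) unfolding K_def by (metis (mono_tags, lifting) mem_Collect_eq mult_pos_pos)
      then have "k * q \<le> k * 1" using k_max by simp
      then have "q = 1" using k pq(2) by simp
      have "z - of_int p * T k j = of_rat (x - of_int p * of_int (\<Delta> - 2 * j) / of_int (2 * k))"
        using k unfolding xy y \<open>q = 1\<close> T_def quad_gen_def
        by (simp add: of_rat_divide of_rat_add of_rat_diff of_rat_mult field_simps)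
      moreover have "z - of_int p * T k j \<in> J"
        using fractional_ideal_diff[OF J z fractional_ideal_int[OF J T]] by blast
      ultimately obtain a where "z - of_int p * T k j = of_int a"
        using rat by fastforce
      then have "z = of_int a + of_int p * T k j" by (simp add: algebra_simps)
      then show "z \<in> {of_int a + of_int b * T k j | a b. True}" by blast
    qed
  qed
  ultimately show thesis using that k j unfolding T_def by blast
qed

section \<open>Ideal classes\<close>

lemma ideal_mult_principal_left:
  assumes I: "fractional_ideal \<Delta> I"
  shows "ideal_mult ((*) x ` quad_order \<Delta>) I = (*) x ` I"
proof
  show "ideal_mult ((*) x ` quad_order \<Delta>) I \<subseteq> (*) x ` I"
  proof
    fix z assume "z \<in> ideal_mult ((*) x ` quad_order \<Delta>) I"
    then show "z \<in> (*) x ` I"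
    proof (induction rule: ideal_mult_induct)
      case zero
      show ?case using I by (intro image_eqI[of _ _ 0]) (simp_all add: fractional_ideal_def)
    next
      case (add a b z)
      then obtain r y where "a = x * r" "z = x * y" and ry: "r \<in> quad_order \<Delta>" "y \<in> I" by blast
      then have "a * b + z = x * (r * b + y)" by (simp add: algebra_simps)
      moreover have "r * b + y \<in> I"
        using fractional_ideal_add[OF I fractional_ideal_scale[OF I]] ry add by blast
      ultimately show ?case by blast
    qed
  qed
  show "(*) x ` I \<subseteq> ideal_mult ((*) x ` quad_order \<Delta>) I"
  proof clarify
    fix y assume "y \<in> I"
    then have "(x * 1) * y \<in> ideal_mult ((*) x ` quad_order \<Delta>) I"
      using quad_order_1 by (intro ideal_mult_prod) blast+
    then show "x * y \<in> ideal_mult ((*) x ` quad_order \<Delta>) I" by simp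
  qed
qed

lemma invertible_ideal_carrier:
  "I \<in> carrier (invertible_ideal_group \<Delta>) \<longleftrightarrow>
     fractional_ideal \<Delta> I \<and> (\<exists>J. fractional_ideal \<Delta> J \<and> ideal_mult I J = quad_order \<Delta>)"
  by (simp add: invertible_ideal_group_def)

lemma class_group_carrier:
  "carrier (class_group \<Delta>) =
     (\<lambda>I. principal_ideals \<Delta> #>\<^bsub>invertible_ideal_group \<Delta>\<^esub> I) ` carrier (invertible_ideal_group \<Delta>)"
  by (auto simp: class_group_def FactGroup_def RCOSETS_def)

lemma class_group_one: "\<one>\<^bsub>class_group \<Delta>\<^esub> = principal_ideals \<Delta>"
  by (simp add: class_group_def FactGroup_def)

lemma ideal_class_eq_one_iff:
  assumes I: "I \<in> carrier (invertible_ideal_group \<Delta>)"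
  shows "principal_ideals \<Delta> #>\<^bsub>invertible_ideal_group \<Delta>\<^esub> I = principal_ideals \<Delta> \<longleftrightarrow> I \<in> principal_ideals \<Delta>"
proof -
  interpret comm_group "invertible_ideal_group \<Delta>" by (rule comm_group_invertible_ideals)
  show ?thesis
    using rcos_self[OF I subgroup_principal_ideals] coset_join2[OF I subgroup_principal_ideals] by auto
qed

text \<open>Dividing \<open>I\<close> by an element of least absolute norm stays in the class, puts
  \<open>1\<close> into the ideal and makes 1 the least absolute norm of a nonzero element.\<close>

lemma reduced_ideal_in_class:
  assumes \<Delta>: "quad_discriminant \<Delta>" and I: "I \<in> carrier (invertible_ideal_group \<Delta>)"
  obtains k j J where "J \<in> carrier (invertible_ideal_group \<Delta>)"
    "principal_ideals \<Delta> #>\<^bsub>invertible_ideal_group \<Delta>\<^esub> I = principal_ideals \<Delta> #>\<^bsub>invertible_ideal_group \<Delta>\<^esub> J"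
    "k > 0" "3 * k\<^sup>2 \<le> \<bar>\<Delta>\<bar>" "\<bar>\<Delta> - 2 * j\<bar> \<le> k" "4 * k dvd (\<Delta> - 2 * j)\<^sup>2 - \<Delta>"
    "J = {of_int a + of_int b * ((quad_gen \<Delta> - of_int j) / of_int k) | a b. True}"
proof -
  let ?G = "invertible_ideal_group \<Delta>" and ?P = "principal_ideals \<Delta>"
  interpret comm_group ?G by (rule comm_group_invertible_ideals)
  have fI: "fractional_ideal \<Delta> I" using I invertible_ideal_carrier by blast
  obtain \<alpha> where \<alpha>: "\<alpha> \<in> I" "\<alpha> \<noteq> 0"
    and min: "\<And>z. z \<in> I \<Longrightarrow> z \<noteq> 0 \<Longrightarrow> \<bar>quad_norm \<Delta> \<alpha>\<bar> \<le> \<bar>quad_norm \<Delta> z\<bar>"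
    using fractional_ideal_least_norm[OF \<Delta> fI] by blast
  have \<alpha>K: "\<alpha> \<in> quad_field \<Delta>" using fractional_ideal_field[OF fI \<alpha>(1)] .
  let ?A = "(*) (inverse \<alpha>) ` quad_order \<Delta>"
  define J where "J = (*) (inverse \<alpha>) ` I"
  have J_mult: "J = ?A \<otimes>\<^bsub>?G\<^esub> I"
    using ideal_mult_principal_left[OF fI] by (simp add: J_def invertible_ideal_group_def)
  have AP: "?A \<in> ?P"
    unfolding principal_ideals_def using \<alpha>(2) quad_field_inverse[OF \<alpha>K]
    by (intro CollectI exI[of _ "inverse \<alpha>"]) simp
  have A: "?A \<in> carrier ?G" using subgroup.mem_carrier[OF subgroup_principal_ideals AP] .
  have JG: "J \<in> carrier ?G" unfolding J_mult using A I by simp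
  have "J \<in> ?P #>\<^bsub>?G\<^esub> I" unfolding J_mult r_coset_def using AP by blast
  then have coset: "?P #>\<^bsub>?G\<^esub> I = ?P #>\<^bsub>?G\<^esub> J"
    using repr_independence I subgroup_principal_ideals by blast
  have fJ: "fractional_ideal \<Delta> J" using JG invertible_ideal_carrier by blast
  have "inverse \<alpha> * \<alpha> \<in> J" unfolding J_def using \<alpha>(1) by blast
  then have "1 \<in> J" using \<alpha> by simp
  moreover have "1 \<le> \<bar>quad_norm \<Delta> z\<bar>" if z: "z \<in> J" "z \<noteq> 0" for z
  proof -
    obtain y where y: "y \<in> I" "z = inverse \<alpha> * y" using z unfolding J_def by blast
    then have "y = \<alpha> * z" "y \<noteq> 0" using \<alpha> z by auto
    then have "quad_norm \<Delta> y = quad_norm \<Delta> \<alpha> * quad_norm \<Delta> z"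
      using quad_norm_mult[OF \<Delta> \<alpha>K fractional_ideal_field[OF fJ z(1)]] by simp
    then have "\<bar>quad_norm \<Delta> \<alpha>\<bar> * 1 \<le> \<bar>quad_norm \<Delta> \<alpha>\<bar> * \<bar>quad_norm \<Delta> z\<bar>"
      using min[OF y(1) \<open>y \<noteq> 0\<close>] by (simp add: abs_mult)
    then show ?thesis using quad_norm_nonzero[OF \<Delta> \<alpha>K \<alpha>(2)] by simp
  qed
  ultimately obtain k j where "k > 0" "3 * k\<^sup>2 \<le> \<bar>\<Delta>\<bar>" "\<bar>\<Delta> - 2 * j\<bar> \<le> k" "4 * k dvd (\<Delta> - 2 * j)\<^sup>2 - \<Delta>"
    "J = {of_int a + of_int b * ((quad_gen \<Delta> - of_int j) / of_int k) | a b. True}"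
    by (rule reduced_ideal_basis[OF \<Delta> fJ])
  then show thesis by (rule that[OF JG coset])
qed

lemma finite_class_group:
  assumes "quad_discriminant \<Delta>"
  shows "finite (carrier (class_group \<Delta>))"
proof (rule finite_subset)
  let ?G = "invertible_ideal_group \<Delta>" and ?P = "principal_ideals \<Delta>"
  let ?f = "\<lambda>(k, j). ?P #>\<^bsub>?G\<^esub>
    {of_int a + of_int b * ((quad_gen \<Delta> - of_int j) / of_int k) | a b. True}"
  \<comment> \<open>A crude box: \<open>k \<le> k\<^sup>2\<close> bounds \<open>k\<close> by
    \<open>\<bar>\<Delta>\<bar>\<close>, and then
    \<open>\<bar>\<Delta> - 2 * j\<bar> \<le> k\<close> bounds \<open>j\<close>.\<close>
  let ?B = "{0..\<bar>\<Delta>\<bar>} \<times> {- (2 * \<bar>\<Delta>\<bar>)..2 * \<bar>\<Delta>\<bar>}"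
  show "finite (?f ` ?B)" by simp
  show "carrier (class_group \<Delta>) \<subseteq> ?f ` ?B"
  proof
    fix c assume "c \<in> carrier (class_group \<Delta>)"
    then obtain I where I: "I \<in> carrier ?G" "c = ?P #>\<^bsub>?G\<^esub> I" unfolding class_group_carrier by blast
    obtain k j J where J: "J \<in> carrier ?G" "?P #>\<^bsub>?G\<^esub> I = ?P #>\<^bsub>?G\<^esub> J" "k > 0" "3 * k\<^sup>2 \<le> \<bar>\<Delta>\<bar>"
      "\<bar>\<Delta> - 2 * j\<bar> \<le> k" "4 * k dvd (\<Delta> - 2 * j)\<^sup>2 - \<Delta>"
      "J = {of_int a + of_int b * ((quad_gen \<Delta> - of_int j) / of_int k) | a b. True}"
      by (rule reduced_ideal_in_class[OF assms I(1)])
    have "k * 1 \<le> k * k" using J by (intro mult_left_mono) auto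
    then have "k \<le> \<bar>\<Delta>\<bar>" using J unfolding power2_eq_square mult_1_right by linarith
    then have "(k, j) \<in> ?B" using J by auto
    moreover have "c = ?f (k, j)" using I J by simp
    ultimately show "c \<in> ?f ` ?B" by (rule rev_image_eqI)
  qed
qed

section \<open>The class number for discriminant 32\<close>

lemma class_number_32: "class_number 32 = 1"
proof -
  let ?G = "invertible_ideal_group 32" and ?P = "principal_ideals 32" and ?w = "quad_gen 32"
  interpret comm_group ?G by (rule comm_group_invertible_ideals)
  have \<Delta>: "quad_discriminant 32"
  proof -
    have "k\<^sup>2 \<noteq> 32" for k :: int
    proof
      assume k: "k\<^sup>2 = 32"
      have "\<bar>k\<bar> < 6" using power2_less_imp_less[of "\<bar>k\<bar>" 6] k by simp
      moreover have "5 < \<bar>k\<bar>" using power2_less_imp_less[of 5 "\<bar>k\<bar>"] k by simp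
      ultimately show False by simp
    qed
    then have "\<nexists>k::int. 32 = k\<^sup>2" by metis
    then show ?thesis by (simp add: quad_discriminant_def)
  qed
  have "?P #>\<^bsub>?G\<^esub> I = ?P" if I: "I \<in> carrier ?G" for I
  proof -
    obtain k j J where J: "J \<in> carrier ?G" "?P #>\<^bsub>?G\<^esub> I = ?P #>\<^bsub>?G\<^esub> J"
      and k: "k > 0" "3 * k\<^sup>2 \<le> \<bar>32\<bar>" and j: "\<bar>32 - 2 * j\<bar> \<le> k" "4 * k dvd (32 - 2 * j)\<^sup>2 - 32"
      and J_eq: "J = {of_int a + of_int b * ((?w - of_int j) / of_int k) | a b. True}"
      by (rule reduced_ideal_in_class[OF \<Delta> I])
    have "k < 4" using k power2_less_imp_less[of k 4] by simp
    then consider "k = 1" | "k = 2" | "k = 3" using k by linarith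
    then show ?thesis
    proof cases
      case 1
      \<comment> \<open>For \<open>k = 1\<close> the basis differs from \<open>1, w\<close> only by
        an integer shift.\<close>
      have "J = quad_order 32"
        unfolding J_eq 1 quad_order_eq[OF \<Delta>]
      proof safe
        fix a b :: int
        show "\<exists>a' b'. of_int a + of_int b * ((?w - of_int j) / of_int 1) = of_int a' + of_int b' * ?w \<and> True"
          by (rule exI[of _ "a - b * j"], rule exI[of _ b]) (simp add: algebra_simps)
        show "\<exists>a' b'. of_int a + of_int b * ?w = of_int a' + of_int b' * ((?w - of_int j) / of_int 1) \<and> True"
          by (rule exI[of _ "a + b * j"], rule exI[of _ b]) (simp add: algebra_simps)
      qed
      then have "J \<in> ?P"
        using subgroup.one_closed[OF subgroup_principal_ideals] by (simp add: invertible_ideal_group_def)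
      then show ?thesis using J ideal_class_eq_one_iff by metis
    next
      case 2
      then have "j = 15 \<or> j = 16 \<or> j = 17" using j by auto
      \<comment> \<open>For \<open>j = 15\<close> and \<open>j = 17\<close> the dividend is -28, not
        divisible by 8.\<close>
      then have "j = 16" using j 2 by auto
      \<comment> \<open>\<open>t\<close> equals \<open>\<surd>32 / 4\<close>, that is,
        \<surd>2.\<close>
      define t where "t = (?w - 16) / 2"
      have J_t: "J = {of_int a + of_int b * t | a b. True}"
        unfolding J_eq t_def 2 \<open>j = 16\<close> by simp
      have "4 * (4 * (t * t)) = 4 * 8"
        using csqrt_sq[of "of_int 32"] unfolding t_def quad_gen_def by (simp add: field_simps)
      then have tt: "t * t = 2" by simp
      have tJ: "t * x \<in> J" if x: "x \<in> J" for x
      proof -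
        obtain a b where "x = of_int a + of_int b * t" using x unfolding J_t by blast
        then have "t * x = of_int a * t + of_int b * (t * t)" by (simp add: algebra_simps)
        then have "t * x = of_int (2 * b) + of_int a * t" unfolding tt by simp
        then show ?thesis unfolding J_t by blast
      qed
      text \<open>\<open>J\<close> is an ideal of the larger ring \<open>\<int>[\<surd>2]\<close>, hence not invertible.\<close>
      obtain L where L: "ideal_mult J L = quad_order 32"
        using J invertible_ideal_carrier by blast
      have "t * z \<in> ideal_mult J L" if z: "z \<in> ideal_mult J L" for z
        using z
      proof (induction rule: ideal_mult_induct)
        case zero
        then show ?case by (simp add: ideal_mult_0)
      next
        case (add x y z)
        then have "(t * x) * y + t * z \<in> ideal_mult J L"
          using ideal_mult_add[OF ideal_mult_prod[OF tJ]] by blast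
        then show ?case by (simp add: algebra_simps)
      qed
      \<comment> \<open>Since \<open>1\<close> lies in \<open>J L\<close>, so does \<surd>2. But its
        irrational coordinate is 1/4, while elements of the order have half-integers there.\<close>
      then have "t * 1 \<in> quad_order 32" unfolding L using quad_order_1 by blast
      then obtain a b where ab: "t = of_int a + of_int b * ?w"
        unfolding quad_order_eq[OF \<Delta>] by auto
      have "t = of_rat 0 + of_rat (1 / 4) * csqrt (of_int 32)"
        by (simp add: t_def quad_gen_def of_rat_divide field_simps)
      then have "of_int b / 2 = (1 / 4 :: rat)"
        using ab quad_coords_unique[OF \<Delta>] unfolding quad_gen_coords by metis
      then have "of_int (2 * b) = (of_int 1 :: rat)" by simp
      then have "2 * b = 1" by (simp only: of_int_eq_iff)
      then have False by presburger
      then show ?thesis ..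
    next
      case 3
      then have "j = 15 \<or> j = 16 \<or> j = 17" using j by auto
      \<comment> \<open>The dividend is -28 or -32, neither divisible by 12.\<close>
      then have False using j 3 by auto
      then show ?thesis ..
    qed
  qed
  then have "carrier (class_group 32) \<subseteq> {?P}" unfolding class_group_carrier by blast
  moreover have "?P \<in> carrier (class_group 32)"
    using group.is_monoid[OF comm_group.axioms(2)[OF comm_group_class_group], THEN monoid.one_closed]
    unfolding class_group_one .
  ultimately have "carrier (class_group 32) = {?P}" by blast
  then show ?thesis by (simp add: class_number_def Coset.order_def)
qed

section \<open>Ideals with principal square and classes of order two\<close>

text \<open>From \<open>I\<^sup>2 = (c)\<close> the inverse of \<open>I\<close> is \<open>I\<close>
  times the principal ideal of \<open>inverse c\<close>.\<close>

lemma invertible_of_principal_square: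
  assumes I: "fractional_ideal \<Delta> I" and sq: "ideal_mult I I = (*) c ` quad_order \<Delta>"
    and c: "c \<in> quad_field \<Delta>" "c \<noteq> 0"
  shows "I \<in> carrier (invertible_ideal_group \<Delta>)"
proof -
  let ?C = "(*) (inverse c) ` quad_order \<Delta>"
  have "fractional_ideal \<Delta> (ideal_mult I ?C)"
    using I c by (intro fractional_ideal_mult fractional_ideal_principal quad_field_inverse) auto
  moreover have "ideal_mult I (ideal_mult I ?C) = quad_order \<Delta>"
    using c by (simp add: sq ideal_mult_principal flip: ideal_mult_assoc)
  ultimately show ?thesis using I invertible_ideal_carrier by blast
qed

lemma class_number_one_imp_principal:
  assumes "class_number \<Delta> = 1" and I: "I \<in> carrier (invertible_ideal_group \<Delta>)"
  shows "I \<in> principal_ideals \<Delta>"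
proof -
  obtain c where c: "carrier (class_group \<Delta>) = {c}"
    using assms(1) by (auto simp: class_number_def Coset.order_def card_1_singleton_iff)
  have "principal_ideals \<Delta> \<in> carrier (class_group \<Delta>)"
    using group.is_monoid[OF comm_group.axioms(2)[OF comm_group_class_group], THEN monoid.one_closed]
    unfolding class_group_one .
  moreover have "principal_ideals \<Delta> #>\<^bsub>invertible_ideal_group \<Delta>\<^esub> I \<in> carrier (class_group \<Delta>)"
    unfolding class_group_carrier using I by blast
  ultimately show ?thesis using c ideal_class_eq_one_iff[OF I] by auto
qed

text \<open>The class of \<open>I\<close> is nontrivial with trivial square, so it has order 2;
  Lagrange's theorem does the rest.\<close>

lemma even_class_number:
  assumes fin: "finite (carrier (class_group \<Delta>))"
    and I: "fractional_ideal \<Delta> I" and sq: "ideal_mult I I = (*) c ` quad_order \<Delta>"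
    and c: "c \<in> quad_field \<Delta>" "c \<noteq> 0" and np: "I \<notin> principal_ideals \<Delta>"
  shows "even (class_number \<Delta>)"
proof -
  let ?G = "invertible_ideal_group \<Delta>" and ?P = "principal_ideals \<Delta>" and ?C = "class_group \<Delta>"
  interpret G: comm_group ?G by (rule comm_group_invertible_ideals)
  interpret C: comm_group ?C by (rule comm_group_class_group)
  interpret N: normal ?P ?G
    by (rule G.subgroup_imp_normal[OF subgroup_principal_ideals])
  have IG: "I \<in> carrier ?G" by (rule invertible_of_principal_square[OF I sq c])
  define x where "x = ?P #>\<^bsub>?G\<^esub> I"
  have x: "x \<in> carrier ?C" unfolding x_def class_group_carrier using IG by blast
  have "x \<otimes>\<^bsub>?C\<^esub> x = ?P #>\<^bsub>?G\<^esub> (I \<otimes>\<^bsub>?G\<^esub> I)"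
    using N.rcos_sum[OF IG IG] by (simp add: x_def class_group_def FactGroup_def)
  also have "\<dots> = ?P"
  proof -
    have "I \<otimes>\<^bsub>?G\<^esub> I \<in> ?P"
      unfolding principal_ideals_def using sq c
      by (intro CollectI exI[of _ c]) (simp add: invertible_ideal_group_def)
    then show ?thesis using ideal_class_eq_one_iff G.m_closed[OF IG IG] by blast
  qed
  finally have "x [^]\<^bsub>?C\<^esub> (2::nat) = \<one>\<^bsub>?C\<^esub>"
    using x by (simp add: numeral_2_eq_2 flip: class_group_one)
  then have "C.ord x dvd 2" using C.pow_eq_id[OF x] by blast
  moreover have "x \<noteq> \<one>\<^bsub>?C\<^esub>" unfolding x_def class_group_one using ideal_class_eq_one_iff[OF IG] np by blast
  then have "C.ord x \<noteq> 1" using C.ord_eq_1[OF x] by blast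
  ultimately have "C.ord x = 2" by (metis prime_nat_iff two_is_prime_nat)
  then show ?thesis
    using C.ord_dvd_group_order[OF x] by (simp add: class_number_def)
qed

text \<open>For a generator \<alpha>, the elements \<open>\<alpha>\<^sup>2\<close> and
  \<open>c\<close> generate the same ideal, so each is a multiple of the other in the order. Taking
  norms, the squares of \<open>c\<close> and of the norm of \<alpha> divide each other. This turns
  principality into a Pell-type equation.\<close>

lemma principal_square_norm:
  assumes \<Delta>: "quad_discriminant \<Delta>" and "I \<in> principal_ideals \<Delta>" and "I \<subseteq> quad_order \<Delta>"
    and sq: "ideal_mult I I = (*) (of_int c) ` quad_order \<Delta>"
  obtains \<alpha> where "\<alpha> \<in> I" "\<bar>quad_norm \<Delta> \<alpha>\<bar> = of_int \<bar>c\<bar>"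
proof -
  obtain \<alpha> where \<alpha>: "I = (*) \<alpha> ` quad_order \<Delta>" "\<alpha> \<in> quad_field \<Delta>"
    using assms(2) unfolding principal_ideals_def by blast
  have "\<alpha> * 1 \<in> I" unfolding \<alpha>(1) using quad_order_1 by blast
  then have \<alpha>I: "\<alpha> \<in> I" by simp
  have eq: "(*) (\<alpha> * \<alpha>) ` quad_order \<Delta> = (*) (of_int c) ` quad_order \<Delta>"
    using sq unfolding \<alpha>(1) ideal_mult_principal .
  have "\<alpha> * \<alpha> * 1 \<in> (*) (of_int c) ` quad_order \<Delta>" unfolding eq[symmetric] using quad_order_1 by blast
  then obtain u where u: "u \<in> quad_order \<Delta>" "\<alpha> * \<alpha> = of_int c * u" by auto
  have "of_int c * 1 \<in> (*) (\<alpha> * \<alpha>) ` quad_order \<Delta>" unfolding eq using quad_order_1 by blast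
  then obtain v where v: "v \<in> quad_order \<Delta>" "of_int c = \<alpha> * \<alpha> * v" by auto
  have K: "u \<in> quad_field \<Delta>" "v \<in> quad_field \<Delta>" "of_int c \<in> quad_field \<Delta>" "\<alpha> * \<alpha> \<in> quad_field \<Delta>"
    using u v \<alpha> quad_order_subset_field quad_order_int quad_field_mult by blast+
  obtain a b e where abe: "quad_norm \<Delta> \<alpha> = of_int a" "quad_norm \<Delta> u = of_int b" "quad_norm \<Delta> v = of_int e"
    using quad_norm_order[OF \<Delta>] u v \<alpha>I assms(3) by (meson subsetD)
  have nc: "quad_norm \<Delta> (of_int c) = of_int (c * c)"
    using quad_norm_of_rat[OF \<Delta>, of "of_int c"] by (simp add: power2_eq_square)
  have "(of_int (a * a) :: rat) = of_int (c * c * b)"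
    using arg_cong[OF u(2), of "quad_norm \<Delta>"] abe nc K \<alpha>(2) by (simp add: quad_norm_mult[OF \<Delta>])
  then have "a * a = c * c * b" by (simp only: of_int_eq_iff)
  then have "c\<^sup>2 dvd a\<^sup>2" unfolding power2_eq_square by (rule dvdI)
  moreover have "(of_int (c * c) :: rat) = of_int (a * a * e)"
    using arg_cong[OF v(2), of "quad_norm \<Delta>"] abe nc K \<alpha>(2) by (simp add: quad_norm_mult[OF \<Delta>])
  then have "c * c = a * a * e" by (simp only: of_int_eq_iff)
  then have "a\<^sup>2 dvd c\<^sup>2" unfolding power2_eq_square by (rule dvdI)
  ultimately have "a dvd c" "c dvd a" by simp_all
  then have "\<bar>a\<bar> = \<bar>c\<bar>" by (rule zdvd_antisym_abs)
  then show thesis using that[OF \<alpha>I] abe(1) by simp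
qed

section \<open>Pell-type equations\<close>

text \<open>Infinite descent: multiplying a solution by the unit \<open>m - \<surd>(m\<^sup>2 - 1)\<close> of norm \<open>1\<close> shrinks \<open>\<bar>y\<bar>\<close>.\<close>

lemma pell_pm2_unsolvable:
  fixes m x y :: int
  assumes m: "m \<ge> 3"
  shows "\<bar>x\<^sup>2 - (m\<^sup>2 - 1) * y\<^sup>2\<bar> \<noteq> 2"
proof (induction "nat \<bar>y\<bar>" arbitrary: x y rule: less_induct)
  case less
  show ?case
  proof
    assume eq: "\<bar>x\<^sup>2 - (m\<^sup>2 - 1) * y\<^sup>2\<bar> = 2"
    define u v where "u = \<bar>x\<bar>" and "v = \<bar>y\<bar>"
    have uv: "\<bar>u\<^sup>2 - (m\<^sup>2 - 1) * v\<^sup>2\<bar> = 2" "u \<ge> 0" "v \<ge> 0"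
      using eq by (simp_all add: u_def v_def)
    have "v \<noteq> 0"
    proof
      assume "v = 0"
      then have "u * u = 2" using uv by (simp add: power2_eq_square)
      moreover have "u * u \<le> 1 * 1" if "u \<le> 1" using uv that by (intro mult_mono) auto
      moreover have "2 * 2 \<le> u * u" if "2 \<le> u" using uv that by (intro mult_mono) auto
      ultimately show False by linarith
    qed
    then have "1 \<le> v" using uv by simp
    then have "1\<^sup>2 \<le> v\<^sup>2" by (intro power_mono) auto
    then have v2: "1 \<le> v\<^sup>2" by simp
    \<comment> \<open>The gap between \<open>(m\<^sup>2 - 1) * v\<^sup>2\<close> and
      \<open>((m - 1) * v)\<^sup>2\<close> is \<open>2 * (m - 1) * v\<^sup>2\<close>, at least 4 and
      so larger than the error 2. For \<open>m = 2\<close> it can be just 2, and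
      \<open>1 - 3 = -2\<close> is a solution.\<close>
    have "2 * 2 * 1 \<le> 2 * (m - 1) * v\<^sup>2" using m v2 by (intro mult_mono) auto
    then have "((m - 1) * v)\<^sup>2 < u\<^sup>2"
      using uv(1) by (simp add: power2_eq_square algebra_simps)
    then have lo: "(m - 1) * v < u" by (rule power2_less_imp_less) (use uv in simp)
    have "2 * 2 * 1 \<le> 2 * (m + 1) * v\<^sup>2" using m v2 by (intro mult_mono) auto
    then have "u\<^sup>2 < ((m + 1) * v)\<^sup>2"
      using uv(1) by (simp add: power2_eq_square algebra_simps)
    then have hi: "u < (m + 1) * v" by (rule power2_less_imp_less) (use uv m in simp)
    have "\<bar>m * v - u\<bar> < v" using lo hi by (simp add: algebra_simps)
    then have "nat \<bar>m * v - u\<bar> < nat \<bar>y\<bar>" by (simp add: v_def)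
    from less[OF this, of "m * u - (m\<^sup>2 - 1) * v"]
    have "\<bar>(m * u - (m\<^sup>2 - 1) * v)\<^sup>2 - (m\<^sup>2 - 1) * (m * v - u)\<^sup>2\<bar> \<noteq> 2" .
    moreover have "(m * u - (m\<^sup>2 - 1) * v)\<^sup>2 - (m\<^sup>2 - 1) * (m * v - u)\<^sup>2 = u\<^sup>2 - (m\<^sup>2 - 1) * v\<^sup>2"
      by (simp add: power2_eq_square algebra_simps)
    ultimately show False using uv(1) by simp
  qed
qed

text \<open>The descent now uses the unit \<open>(2k + 1) - 2\<surd>(k(k + 1))\<close>, which preserves the parity of \<open>y\<close>.\<close>

lemma pell_pm1_even:
  fixes k x y :: int
  assumes k: "k \<ge> 2" and "\<bar>x\<^sup>2 - k * (k + 1) * y\<^sup>2\<bar> = 1"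
  shows "even y"
  using assms(2)
proof (induction "nat \<bar>y\<bar>" arbitrary: x y rule: less_induct)
  case less
  show ?case
  proof (rule ccontr)
    assume "odd y"
    define u v where "u = \<bar>x\<bar>" and "v = \<bar>y\<bar>"
    have uv: "\<bar>u\<^sup>2 - k * (k + 1) * v\<^sup>2\<bar> = 1" "u \<ge> 0" "v \<ge> 0" "odd v"
      using less.prems \<open>odd y\<close> by (simp_all add: u_def v_def)
    then have "1 \<le> v" by presburger
    then have "1\<^sup>2 \<le> v\<^sup>2" by (intro power_mono) auto
    then have v2: "1 \<le> v\<^sup>2" by simp
    \<comment> \<open>The gap between \<open>k * (k + 1) * v\<^sup>2\<close> and
      \<open>(k * v)\<^sup>2\<close> is \<open>k * v\<^sup>2\<close>, which exceeds the error 1. For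
      \<open>k = 1\<close> the claim fails, as \<open>1 - 2 = -1\<close> has
      \<open>y = 1\<close>.\<close>
    have "2 * 1 \<le> k * v\<^sup>2" using k v2 by (intro mult_mono) auto
    then have "(k * v)\<^sup>2 < u\<^sup>2"
      using uv(1) by (simp add: power2_eq_square algebra_simps)
    then have lo: "k * v < u" by (rule power2_less_imp_less) (use uv in simp)
    have "2 * 1 \<le> (k + 1) * v\<^sup>2" using k v2 by (intro mult_mono) auto
    then have "u\<^sup>2 < ((k + 1) * v)\<^sup>2"
      using uv(1) by (simp add: power2_eq_square algebra_simps)
    then have hi: "u < (k + 1) * v" by (rule power2_less_imp_less) (use uv k in simp)
    have "\<bar>(2 * k + 1) * v - 2 * u\<bar> < v" using lo hi by (simp add: algebra_simps)
    then have "nat \<bar>(2 * k + 1) * v - 2 * u\<bar> < nat \<bar>y\<bar>" by (simp add: v_def)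
    moreover have "((2 * k + 1) * u - 2 * k * (k + 1) * v)\<^sup>2 - k * (k + 1) * ((2 * k + 1) * v - 2 * u)\<^sup>2
        = u\<^sup>2 - k * (k + 1) * v\<^sup>2"
      by (simp add: power2_eq_square algebra_simps)
    ultimately have "even ((2 * k + 1) * v - 2 * u)" using less.hyps uv(1) by metis
    with uv(4) show False by simp
  qed
qed

section \<open>Ideals of order two\<close>

text \<open>\<open>half_sqrt D\<close> is \<open>\<surd>D\<close>, written so that it matches the generator \<open>\<surd>(4D)\<close> of \<open>quad_field (4 * D)\<close>.\<close>

definition half_sqrt :: "int \<Rightarrow> complex" where
  "half_sqrt D = csqrt (of_int (4 * D)) / 2"

text \<open>Integer coordinates for \<int>[\<surd>D], the order of discriminant
  \<open>4 * D\<close>, so that ideal arithmetic becomes congruences between integers.\<close>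

definition quad_int :: "int \<Rightarrow> int \<Rightarrow> int \<Rightarrow> complex" where
  "quad_int D x y = of_int x + of_int y * half_sqrt D"

lemma half_sqrt_sq: "half_sqrt D * half_sqrt D = of_int D"
  using csqrt_sq[of "of_int (4 * D)"] by (simp add: half_sqrt_def)

lemma quad_int_0: "quad_int D 0 0 = 0"
  and quad_int_of_int: "quad_int D a 0 = of_int a"
  and quad_int_add: "quad_int D x y + quad_int D x' y' = quad_int D (x + x') (y + y')"
  and quad_int_of_int_mult: "of_int a * quad_int D x y = quad_int D (a * x) (a * y)"
  by (simp_all add: quad_int_def algebra_simps)

lemma quad_int_mult:
  "quad_int D x y * quad_int D x' y' = quad_int D (x * x' + D * y * y') (x * y' + x' * y)"
proof -
  have "quad_int D x y * quad_int D x' y'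
      = of_int (x * x') + of_int (y * y') * (half_sqrt D * half_sqrt D) + of_int (x * y' + x' * y) * half_sqrt D"
    by (simp add: quad_int_def algebra_simps)
  then show ?thesis unfolding half_sqrt_sq by (simp add: quad_int_def algebra_simps)
qed

lemma quad_int_coords:
  "quad_int D x y = of_rat (of_int x) + of_rat (of_int y / 2) * csqrt (of_int (4 * D))"
  by (simp add: quad_int_def half_sqrt_def of_rat_divide)

lemma quad_norm_quad_int:
  assumes "quad_discriminant (4 * D)"
  shows "quad_norm (4 * D) (quad_int D x y) = of_int (x\<^sup>2 - D * y\<^sup>2)"
  unfolding quad_int_coords quad_norm_coords[OF assms] by (simp add: power2_eq_square)

lemma quad_order_quad_int:
  assumes "quad_discriminant (4 * D)"
  shows "quad_order (4 * D) = {quad_int D x y | x y. True}"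
proof -
  have w: "quad_gen (4 * D) = of_int (2 * D) + half_sqrt D"
    by (simp add: quad_gen_def half_sqrt_def field_simps)
  show ?thesis
    unfolding quad_order_eq[OF assms]
  proof safe
    fix a b :: int
    have "of_int a + of_int b * quad_gen (4 * D) = quad_int D (a + 2 * b * D) b"
      unfolding w by (simp add: quad_int_def algebra_simps)
    then show "\<exists>x y. of_int a + of_int b * quad_gen (4 * D) = quad_int D x y \<and> True" by blast
    have "quad_int D a b = of_int (a - 2 * b * D) + of_int b * quad_gen (4 * D)"
      unfolding w by (simp add: quad_int_def algebra_simps)
    then show "\<exists>x y. quad_int D a b = of_int x + of_int y * quad_gen (4 * D) \<and> True" by blast
  qed
qed

text \<open>\<open>mult\<close> is closure under multiplication by \<open>a + b * \<surd>D\<close>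
  in coordinates. The set lies in the order, so \<open>1\<close> is a denominator, and
  \<open>c\<close> is a nonzero element.\<close>

lemma fractional_ideal_lattice:
  fixes P :: "int \<Rightarrow> int \<Rightarrow> bool"
  assumes \<Delta>: "quad_discriminant (4 * D)" and "P 0 0" and nz: "P c 0" "c \<noteq> 0"
    and add: "\<And>x y x' y'. P x y \<Longrightarrow> P x' y' \<Longrightarrow> P (x + x') (y + y')"
    and mult: "\<And>a b x y. P x y \<Longrightarrow> P (a * x + D * b * y) (a * y + x * b)"
  shows "fractional_ideal (4 * D) {quad_int D x y | x y. P x y}"
  unfolding fractional_ideal_def
proof (intro conjI ballI)
  let ?I = "{quad_int D x y | x y. P x y}" and ?O = "quad_order (4 * D)"
  have sub: "?I \<subseteq> ?O" unfolding quad_order_quad_int[OF \<Delta>] by blast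
  then show "?I \<subseteq> quad_field (4 * D)" using quad_order_subset_field by blast
  show "0 \<in> ?I" using \<open>P 0 0\<close> quad_int_0 by fastforce
  have "of_int c \<in> ?I" using nz(1) by (auto simp flip: quad_int_of_int[of D c])
  moreover have "of_int c \<noteq> (0 :: complex)" using nz(2) by simp
  ultimately show "?I \<noteq> {0}" by blast
  show "u + v \<in> ?I" if u: "u \<in> ?I" and v: "v \<in> ?I" for u v
  proof -
    obtain x y x' y' where "u = quad_int D x y" "P x y" "v = quad_int D x' y'" "P x' y'"
      using u v by blast
    then show ?thesis using add quad_int_add by blast
  qed
  show "r * u \<in> ?I" if r: "r \<in> ?O" and u: "u \<in> ?I" for r u
  proof -
    obtain a b x y where "r = quad_int D a b" "u = quad_int D x y" "P x y"
      using r u unfolding quad_order_quad_int[OF \<Delta>] by blast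
    then show ?thesis using mult quad_int_mult by blast
  qed
  show "\<exists>d\<in>?O. d \<noteq> 0 \<and> (\<forall>x\<in>?I. d * x \<in> ?O)"
    using sub quad_order_1 by (intro bexI[of _ 1]) auto
qed

text \<open>All products of two elements are divisible by \<open>c\<close>, which gives one
  inclusion; membership of \<open>c\<close> in the square gives the other.\<close>

lemma ideal_mult_lattice_self:
  fixes P :: "int \<Rightarrow> int \<Rightarrow> bool" and D c :: int
  defines "I \<equiv> {quad_int D x y | x y. P x y}"
  assumes \<Delta>: "quad_discriminant (4 * D)" and I: "fractional_ideal (4 * D) I"
    and prod: "\<And>x y x' y'. P x y \<Longrightarrow> P x' y' \<Longrightarrow> c dvd x * x' + D * y * y' \<and> c dvd x * y' + x' * y"
    and c: "of_int c \<in> ideal_mult I I"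
  shows "ideal_mult I I = (*) (of_int c) ` quad_order (4 * D)"
proof
  show "(*) (of_int c) ` quad_order (4 * D) \<subseteq> ideal_mult I I"
    using fractional_ideal_scale[OF fractional_ideal_mult[OF I I] _ c] by (auto simp: mult.commute)
  show "ideal_mult I I \<subseteq> (*) (of_int c) ` quad_order (4 * D)"
  proof
    fix z assume "z \<in> ideal_mult I I"
    then show "z \<in> (*) (of_int c) ` quad_order (4 * D)"
    proof (induction rule: ideal_mult_induct)
      case zero
      show ?case by (rule image_eqI[of _ _ 0]) (simp_all add: quad_order_0)
    next
      case (add u v z)
      then obtain x y x' y' r where "u = quad_int D x y" "P x y" "v = quad_int D x' y'" "P x' y'"
        and r: "z = of_int c * r" "r \<in> quad_order (4 * D)"
        unfolding I_def by blast
      then obtain p q where "x * x' + D * y * y' = c * p" "x * y' + x' * y = c * q"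
        and uv: "u * v = quad_int D (x * x' + D * y * y') (x * y' + x' * y)"
        using prod by (metis dvdE quad_int_mult)
      then have "u * v + z = of_int c * (quad_int D p q + r)"
        using r by (simp add: quad_int_of_int_mult distrib_left)
      moreover have "quad_int D p q + r \<in> quad_order (4 * D)"
        using r(2) by (intro quad_order_add) (auto simp: quad_order_quad_int[OF \<Delta>])
      ultimately show ?case by blast
    qed
  qed
qed

text \<open>Three terms are what an ideal with two generators calls for: two squares and a mixed
  product span its square.\<close>

lemma ideal_mult_int_comb:
  assumes "fractional_ideal \<Delta> I" "x \<in> ideal_mult I I" "y \<in> ideal_mult I I" "z \<in> ideal_mult I I"
  shows "of_int a * x + of_int b * y + of_int c * z \<in> ideal_mult I I"
  using fractional_ideal_mult[OF assms(1,1)] assms(2-)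
  by (intro fractional_ideal_add fractional_ideal_int) auto

text \<open>For even \<open>m\<close>, \<open>D\<close> is 3 mod 4 and 2 ramifies. The ideal (2, 1 +
  \<surd>D) is described by \<open>even (x + y)\<close>; a generator would have norm 2 or
  -2.\<close>

lemma nonprincipal_ideal_over_2:
  fixes m :: int
  defines "D \<equiv> m\<^sup>2 - 1"
  assumes "even m" "m \<ge> 3" and \<Delta>: "quad_discriminant (4 * D)"
  obtains I where "fractional_ideal (4 * D) I" "ideal_mult I I = (*) (of_int 2) ` quad_order (4 * D)"
    "I \<notin> principal_ideals (4 * D)"
proof -
  obtain t where t: "D = 4 * t + 3"
  proof -
    obtain h where "m = 2 * h" using \<open>even m\<close> by blast
    then have "D = 4 * (h\<^sup>2 - 1) + 3" by (simp add: D_def power_mult_distrib)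
    then show thesis using that by blast
  qed
  define I where "I = {quad_int D x y | x y. even (x + y)}"
  have I: "fractional_ideal (4 * D) I"
    unfolding I_def by (rule fractional_ideal_lattice[OF \<Delta>, where c = 2]) (auto simp: t)
  have mem: "quad_int D x y \<in> I" if "even (x + y)" for x y using that unfolding I_def by blast
  \<comment> \<open>\<open>(1 + \<surd>D)\<^sup>2 - 2 * (1 + \<surd>D) = D - 1 = 4 * t + 2\<close>;
    subtracting \<open>t\<close> times \<open>2 * 2\<close> leaves 2.\<close>
  have "of_int 1 * (quad_int D 1 1 * quad_int D 1 1) + of_int (- 1) * (quad_int D 2 0 * quad_int D 1 1)
      + of_int (- t) * (quad_int D 2 0 * quad_int D 2 0) \<in> ideal_mult I I"
    (is "?e \<in> _")
    by (intro ideal_mult_int_comb[OF I] ideal_mult_prod mem) auto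
  moreover have "?e = of_int 2"
    unfolding quad_int_mult quad_int_of_int_mult quad_int_add by (simp add: t quad_int_def)
  ultimately have 2: "of_int 2 \<in> ideal_mult I I" by (simp only:)
  have sq: "ideal_mult I I = (*) (of_int 2) ` quad_order (4 * D)"
    unfolding I_def
  proof (rule ideal_mult_lattice_self[OF \<Delta>])
    show "fractional_ideal (4 * D) {quad_int D x y | x y. even (x + y)}"
      "of_int 2 \<in> ideal_mult {quad_int D x y | x y. even (x + y)} {quad_int D x y | x y. even (x + y)}"
      using I 2 unfolding I_def by auto
    show "2 dvd x * x' + D * y * y' \<and> 2 dvd x * y' + x' * y"
      if "even (x + y)" "even (x' + y')" for x y x' y'
      using that by (auto simp: t)
  qed
  have "I \<notin> principal_ideals (4 * D)"
  proof
    assume "I \<in> principal_ideals (4 * D)"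
    moreover have "I \<subseteq> quad_order (4 * D)" unfolding I_def quad_order_quad_int[OF \<Delta>] by blast
    ultimately obtain \<alpha> where "\<alpha> \<in> I" and \<alpha>: "\<bar>quad_norm (4 * D) \<alpha>\<bar> = of_int \<bar>2\<bar>"
      using principal_square_norm[OF \<Delta> _ _ sq] by blast
    then obtain x y where "\<alpha> = quad_int D x y" unfolding I_def by blast
    then have "(of_int \<bar>x\<^sup>2 - D * y\<^sup>2\<bar> :: rat) = of_int 2"
      using \<alpha> quad_norm_quad_int[OF \<Delta>, of x y] by simp
    then have "\<bar>x\<^sup>2 - D * y\<^sup>2\<bar> = 2" by (simp only: of_int_eq_iff)
    then show False using pell_pm2_unsolvable[OF \<open>m \<ge> 3\<close>] unfolding D_def by blast
  qed
  then show thesis using that I sq by blast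
qed

text \<open>Here \<open>D = m\<^sup>2 - 1\<close> for \<open>m = 2 * k + 1\<close>. The ideal (4, 2
  + \<surd>D) is described by \<open>4 dvd x - 2 * y\<close>; it plays the part of the ideal over 2,
  even though the order is not maximal.\<close>

lemma nonprincipal_ideal_over_4:
  fixes k :: int
  defines "D \<equiv> 4 * (k * (k + 1))"
  assumes "k \<ge> 2" and \<Delta>: "quad_discriminant (4 * D)"
  obtains I where "fractional_ideal (4 * D) I" "ideal_mult I I = (*) (of_int 4) ` quad_order (4 * D)"
    "I \<notin> principal_ideals (4 * D)"
proof -
  have "even (k * (k + 1))" by simp
  then obtain t where kt: "k * (k + 1) = 2 * t" by blast
  then have t: "D = 8 * t" by (simp add: D_def)
  define P :: "int \<Rightarrow> int \<Rightarrow> bool" where "P x y \<longleftrightarrow> 4 dvd x - 2 * y" for x y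
  have PE: "\<exists>e. x = 2 * y + 4 * e" if "P x y" for x y
    using that unfolding P_def by (metis diff_add_cancel dvdE add.commute)
  have PI: "P x y" if "x = 2 * y + 4 * e" for x y e
    using that unfolding P_def by simp
  define I where "I = {quad_int D x y | x y. P x y}"
  have I: "fractional_ideal (4 * D) I"
    unfolding I_def
  proof (rule fractional_ideal_lattice[OF \<Delta>, where c = 4])
    show "P 0 0" "P 4 0" by (simp_all add: P_def)
    show "P (x + x') (y + y')" if P: "P x y" "P x' y'" for x y x' y'
    proof -
      obtain e e' where "x = 2 * y + 4 * e" "x' = 2 * y' + 4 * e'" using P PE by meson
      then show ?thesis by (intro PI[of _ _ "e + e'"]) simp
    qed
    show "P (a * x + D * b * y) (a * y + x * b)" if P: "P x y" for a b x y
    proof -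
      obtain e where "x = 2 * y + 4 * e" using P PE by meson
      then show ?thesis
        by (intro PI[of _ _ "a * e + 2 * t * b * y - y * b - 2 * e * b"]) (simp add: t algebra_simps)
    qed
  qed simp
  have mem: "quad_int D x y \<in> I" if "P x y" for x y using that unfolding I_def by blast
  \<comment> \<open>\<open>(2 + \<surd>D)\<^sup>2 - 4 * (2 + \<surd>D) = 4 * (2 * t - 1)\<close>.
    Multiplying by \<open>2 * t - 1\<close> gives \<open>16 * (t\<^sup>2 - t) + 4\<close>, and the
    multiple of \<open>4 * 4\<close> removes the first term.\<close>
  have "of_int (2 * t - 1) * (quad_int D 2 1 * quad_int D 2 1) + of_int (1 - 2 * t) * (quad_int D 4 0 * quad_int D 2 1)
      + of_int (t - t * t) * (quad_int D 4 0 * quad_int D 4 0) \<in> ideal_mult I I"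
    (is "?e \<in> _")
    by (intro ideal_mult_int_comb[OF I] ideal_mult_prod mem) (auto simp: P_def)
  moreover have "?e = of_int 4"
    unfolding quad_int_mult quad_int_of_int_mult quad_int_add by (simp add: t quad_int_def algebra_simps)
  ultimately have 4: "of_int 4 \<in> ideal_mult I I" by (simp only:)
  have sq: "ideal_mult I I = (*) (of_int 4) ` quad_order (4 * D)"
    unfolding I_def
  proof (rule ideal_mult_lattice_self[OF \<Delta>])
    show "fractional_ideal (4 * D) {quad_int D x y | x y. P x y}"
      "of_int 4 \<in> ideal_mult {quad_int D x y | x y. P x y} {quad_int D x y | x y. P x y}"
      using I 4 unfolding I_def by auto
    show "4 dvd x * x' + D * y * y' \<and> 4 dvd x * y' + x' * y"
      if P: "P x y" "P x' y'" for x y x' y'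
    proof -
      obtain e e' where e: "x = 2 * y + 4 * e" "x' = 2 * y' + 4 * e'" using P PE by meson
      have "x * x' + D * y * y' = 4 * ((y + 2 * e) * (y' + 2 * e') + 2 * t * y * y')"
        "x * y' + x' * y = 4 * (y * y' + e * y' + e' * y)"
        by (simp_all add: e t algebra_simps)
      then show ?thesis by simp
    qed
  qed
  have "I \<notin> principal_ideals (4 * D)"
  proof
    assume "I \<in> principal_ideals (4 * D)"
    moreover have "I \<subseteq> quad_order (4 * D)" unfolding I_def quad_order_quad_int[OF \<Delta>] by blast
    ultimately obtain \<alpha> where "\<alpha> \<in> I" and \<alpha>: "\<bar>quad_norm (4 * D) \<alpha>\<bar> = of_int \<bar>4\<bar>"
      using principal_square_norm[OF \<Delta> _ _ sq] by blast
    then obtain x y where xy: "\<alpha> = quad_int D x y" "P x y" unfolding I_def by blast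
    then obtain e where e: "x = 2 * y + 4 * e" using PE by meson
    have "(of_int \<bar>x\<^sup>2 - D * y\<^sup>2\<bar> :: rat) = of_int 4"
      using \<alpha> xy quad_norm_quad_int[OF \<Delta>, of x y] by simp
    then have "\<bar>x\<^sup>2 - D * y\<^sup>2\<bar> = 4" by (simp only: of_int_eq_iff)
    moreover have "x\<^sup>2 - D * y\<^sup>2 = 4 * ((y + 2 * e)\<^sup>2 - k * (k + 1) * y\<^sup>2)"
      unfolding e D_def by (simp add: power2_eq_square algebra_simps)
    ultimately have 1: "\<bar>(y + 2 * e)\<^sup>2 - k * (k + 1) * y\<^sup>2\<bar> = 1" by simp
    \<comment> \<open>Both \<open>k * (k + 1)\<close> and \<open>2 * e\<close> are even, so an even
      \<open>y\<close> would make the left side of \<open>1\<close> even.\<close>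
    then have "even y" using pell_pm1_even[OF \<open>k \<ge> 2\<close>] by blast
    then have "even ((y + 2 * e)\<^sup>2 - k * (k + 1) * y\<^sup>2)" by simp
    with 1 show False by (metis dvd_abs_iff odd_one)
  qed
  then show thesis using that I sq by blast
qed

section \<open>Non-maximality in discriminants divisible by 16\<close>

text \<open>The order is \<int>[2\<surd>E], and \<int>[\<surd>E] is a strictly larger order in the
  same field.\<close>

lemma quad_order_not_maximal:
  assumes \<Delta>: "quad_discriminant (16 * E)"
  shows "\<not> maximal_order (16 * E) (quad_order (16 * E))"
proof
  assume max: "maximal_order (16 * E) (quad_order (16 * E))"
  let ?s = "csqrt (of_int (16 * E))"
  define t where "t = ?s / 4"
  define S where "S = {of_int a + of_int b * t | a b. True}"
  have tt: "t * t = of_int E"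
    using csqrt_sq[of "of_int (16 * E)"] by (simp add: t_def)
  have SI: "of_int a + of_int b * t \<in> S" for a b unfolding S_def by blast
  have t_coords: "t = of_rat 0 + of_rat (1 / 4) * ?s" by (simp add: t_def of_rat_divide)
  have sub: "S \<subseteq> quad_field (16 * E)"
  proof
    fix z assume "z \<in> S"
    then obtain a b where "z = of_int a + of_int b * t" unfolding S_def by blast
    then have "z = of_rat (of_int a) + of_rat (of_int b / 4) * ?s"
      by (simp add: t_def of_rat_divide)
    then show "z \<in> quad_field (16 * E)" unfolding quad_field_def by blast
  qed
  have "order_in_quad_field (16 * E) S"
    unfolding order_in_quad_field_def
  proof (intro conjI ballI)
    show "S \<subseteq> quad_field (16 * E)" by (rule sub)
    show "1 \<in> S" using SI[of 1 0] by simp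
    fix x y assume "x \<in> S" "y \<in> S"
    then obtain a b c d where xy: "x = of_int a + of_int b * t" "y = of_int c + of_int d * t"
      unfolding S_def by blast
    show "x - y \<in> S" using SI[of "a - c" "b - d"] by (simp add: xy algebra_simps)
    have "x * y = of_int (a * c) + of_int (b * d) * (t * t) + of_int (a * d + b * c) * t"
      by (simp add: xy algebra_simps)
    also have "\<dots> = of_int (a * c + b * d * E) + of_int (a * d + b * c) * t"
      unfolding tt by simp
    finally show "x * y \<in> S" using SI by metis
  next
    \<comment> \<open>Without this the set \<open>{1, t}\<close> would collapse and the sum over it
      would have a single coefficient.\<close>
    have "t \<noteq> 1"
    proof
      assume "t = 1"
      then have "of_rat 0 + of_rat (1 / 4) * ?s = of_rat 1 + of_rat 0 * ?s" using t_coords by simp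
      from quad_coords_unique[OF \<Delta> this] show False by simp
    qed
    have "S = {\<Sum>b\<in>{1, t}. of_int (c b) * b | c. True}"
    proof safe
      fix z assume "z \<in> S"
      then obtain a b where "z = of_int a + of_int b * t" unfolding S_def by blast
      then have "z = (\<Sum>x\<in>{1, t}. of_int ((\<lambda>x. if x = 1 then a else b) x) * x)"
        using \<open>t \<noteq> 1\<close> by simp
      then show "\<exists>c. z = (\<Sum>b\<in>{1, t}. of_int (c b) * b) \<and> True"
        by (intro exI[of _ "\<lambda>x. if x = 1 then a else b"] conjI) simp_all
    next
      fix c :: "complex \<Rightarrow> int"
      show "(\<Sum>b\<in>{1, t}. of_int (c b) * b) \<in> S"
        using \<open>t \<noteq> 1\<close> SI[of "c 1" "c t"] by simp
    qed
    then show "\<exists>B. finite B \<and> S = {\<Sum>b\<in>B. of_int (c b) * b | c. True}"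
      by (intro exI[of _ "{1, t}"]) simp
    show "quad_field (16 * E) = {of_rat q * x | q x. x \<in> S}"
    proof
      show "{of_rat q * x | q x. x \<in> S} \<subseteq> quad_field (16 * E)"
        using sub quad_field_mult quad_field_Rat by blast
      show "quad_field (16 * E) \<subseteq> {of_rat q * x | q x. x \<in> S}"
      proof
        fix z assume "z \<in> quad_field (16 * E)"
        then obtain a b where z: "z = of_rat a + of_rat b * ?s" by (rule quad_fieldE)
        obtain p q where a: "a = of_int p / of_int q" "q \<noteq> 0"
          by (metis Fract_of_int_quotient Rat_cases less_irrefl)
        obtain r u where b: "b = of_int r / of_int u" "u \<noteq> 0"
          by (metis Fract_of_int_quotient Rat_cases less_irrefl)
        have "z = of_rat (1 / of_int (q * u)) * (of_int (p * u) + of_int (4 * r * q) * t)"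
          using a(2) b(2) by (simp add: z a(1) b(1) t_def of_rat_divide of_rat_mult field_simps)
        then show "z \<in> {of_rat q * x | q x. x \<in> S}" using SI by blast
      qed
    qed
  qed
  moreover have "quad_order (16 * E) \<subseteq> S"
  proof
    fix z assume "z \<in> quad_order (16 * E)"
    then obtain a b where "z = of_int a + of_int b * quad_gen (16 * E)"
      unfolding quad_order_eq[OF \<Delta>] by blast
    then have "z = of_int (a + 8 * b * E) + of_int (2 * b) * t"
      by (simp add: t_def quad_gen_def field_simps)
    then show "z \<in> S" using SI by metis
  qed
  ultimately have "S = quad_order (16 * E)" using max unfolding maximal_order_def by blast
  then have "t \<in> quad_order (16 * E)" using SI[of 0 1] by simp
  then obtain a b where ab: "t = of_int a + of_int b * quad_gen (16 * E)"
    unfolding quad_order_eq[OF \<Delta>] by blast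
  \<comment> \<open>Comparing irrational coordinates: 1/4 for \<open>t\<close>, but half-integers in
    the order.\<close>
  then have "of_int b / 2 = (1 / 4 :: rat)"
    using t_coords quad_coords_unique[OF \<Delta>] unfolding quad_gen_coords by metis
  then have "of_int (2 * b) = (of_int 1 :: rat)" by simp
  then have "2 * b = 1" by (simp only: of_int_eq_iff)
  then show False by presburger
qed

theorem theorem4p5:
  fixes n \<Delta> :: int
  assumes "n \<ge> 0" and "\<Delta> = n\<^sup>2 - 4" and "quad_discriminant \<Delta>"
  shows "(\<forall>m. maximal_order \<Delta> (quad_order \<Delta>) \<and> n = 2 * m \<and> class_number \<Delta> = 1 \<longrightarrow>
            m \<in> {0, 2} \<and> n \<in> {0, 4} \<and> \<Delta> \<in> {-4, 12}) \<and>
         (\<forall>m. n mod 4 = 2 \<and> n = 2 * m \<longrightarrow>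
            (m > 3 \<longrightarrow> finite (carrier (class_group \<Delta>)) \<and> even (class_number \<Delta>)) \<and>
            (m = 3 \<longrightarrow> \<Delta> = 32 \<and> class_number \<Delta> = 1))"
proof (intro conjI allI impI)
  have K: "(of_int a :: complex) \<in> quad_field \<Delta>" for a
    using quad_order_int quad_order_subset_field by blast
  {
    fix m assume m: "maximal_order \<Delta> (quad_order \<Delta>) \<and> n = 2 * m \<and> class_number \<Delta> = 1"
    have \<Delta>: "\<Delta> = 4 * (m\<^sup>2 - 1)" using m assms(2) by (simp add: power_mult_distrib)
    have "even m"
    proof (rule ccontr)
      assume "odd m"
      then obtain k where "m = 2 * k + 1" by (rule oddE)
      then have "\<Delta> = 16 * (k * (k + 1))" unfolding \<Delta>
        by (simp add: power2_eq_square algebra_simps)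
      then show False using quad_order_not_maximal assms(3) m by blast
    qed
    moreover have "\<not> m \<ge> 3"
    proof
      assume "m \<ge> 3"
      then obtain I where I: "fractional_ideal \<Delta> I" "ideal_mult I I = (*) (of_int 2) ` quad_order \<Delta>"
        "I \<notin> principal_ideals \<Delta>"
        using nonprincipal_ideal_over_2[OF \<open>even m\<close>] assms(3) unfolding \<Delta> by blast
      then have "I \<in> carrier (invertible_ideal_group \<Delta>)"
        using invertible_of_principal_square[OF I(1,2) K] by simp
      then show False using class_number_one_imp_principal I m by blast
    qed
    ultimately have "m = 0 \<or> m = 2" using m assms(1) by presburger
    then show "m \<in> {0, 2}" "n \<in> {0, 4}" "\<Delta> \<in> {-4, 12}" using m \<Delta> by auto
  next
    fix m assume m: "n mod 4 = 2 \<and> n = 2 * m"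
    \<comment> \<open>The cardinality of an infinite set is 0 and hence even; finiteness gives the
      parity claim its intended meaning.\<close>
    show fin: "finite (carrier (class_group \<Delta>))" by (rule finite_class_group[OF assms(3)])
    have "odd m" using m by presburger
    then obtain k where k: "m = 2 * k + 1" by (rule oddE)
    have \<Delta>: "\<Delta> = 4 * (4 * (k * (k + 1)))" using assms(2) m unfolding k
      by (simp add: power2_eq_square algebra_simps)
    {
      assume "m > 3"
      \<comment> \<open>The excluded \<open>k = 1\<close> is \<open>m = 3\<close>, that is, \<Delta>
        = 32.\<close>
      then have "k \<ge> 2" using k by simp
      then obtain I where I: "fractional_ideal \<Delta> I" "ideal_mult I I = (*) (of_int 4) ` quad_order \<Delta>"
        "I \<notin> principal_ideals \<Delta>"
        using nonprincipal_ideal_over_4 assms(3) unfolding \<Delta> by blast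
      then show "even (class_number \<Delta>)" using even_class_number[OF fin I(1,2) K] by simp
    next
      assume "m = 3"
      then show "\<Delta> = 32" using m assms(2) by simp
      then show "class_number \<Delta> = 1" using class_number_32 by simp
    }
  }
qed

end
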